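(* Let $n\in\mathbb{N}$ and let the diagonal matrix $\boldsymbol{D}=\mathrm{diag}(d_1,\dots,d_n)$ have $p\in\mathbb{N}_0$ zero diagonal entries, where $p<n$, and $n-p$ positive diagonal entries. Let $i_1,i_2,\dots,i_{n-p}$ be the indices of the positive diagonal entries of $\boldsymbol{D}$ and $i_{n-p+1},i_{n-p+2},\dots,i_n$ the indices of the zero diagonal entries of $\boldsymbol{D}$. For $0\le t_0<t<\infty$ and initial condition $\widehat{\eta}_0(\boldsymbol{y}):=\widehat{\eta}(t_0,\boldsymbol{y})$, the unique solution to $$\frac{\partial \widehat{\eta}}{\partial t}=\Delta_{\boldsymbol{y}}\widehat{\eta}-\left(\boldsymbol{y}^{\top}\boldsymbol{D}\boldsymbol{y}\right)\widehat{\eta}$$ is $$\widehat{\eta}(t,\boldsymbol{y})=\int_{-\infty}^{\infty}\cdots\int_{-\infty}^{\infty}\kappa_{+}(t_0,\boldsymbol{y},t,\boldsymbol{z})\,\widehat{\eta}_0(\boldsymbol{z})\,\mathrm{d}z_1\cdots\mathrm{d}z_n,$$ where the kernel is $$\kappa_{+}(t_0,\boldsymbol{y},t,\boldsymbol{z})=\kappa_{++}\left(t_0,\boldsymbol{y}_{[i_1:i_{n-p}]},t,\boldsymbol{z}_{[i_1:i_{n-p}]}\right)\,\kappa_{0}\left(t_0,\boldsymbol{y}_{[i_{n-p+1}:i_n]},t,\boldsymbol{z}_{[i_{n-p+1}:i_n]}\right),$$ with $\kappa_{++}$ and $\kappa_0$ as defined in the context.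
   Context: $\mathbb{N}_0=\{0,1,2,\dots\}$; $\Delta_{\boldsymbol{y}}$ is the Laplacian in $\boldsymbol{y}\in\mathbb{R}^n$; $\boldsymbol{x}_{[i_1:i_r]}$ denotes the sub-vector $(x_{i_1},\dots,x_{i_r})$ of $\boldsymbol{x}$. Heat kernel on $\mathbb{R}^k$: $\kappa_0(t_0,\boldsymbol{y},t,\boldsymbol{z})=(4\pi(t-t_0))^{-k/2}\exp\left(-\frac{|\boldsymbol{y}-\boldsymbol{z}|^2}{4(t-t_0)}\right)$. Here $k=p$ (the factor is $1$ when $p=0$). Kernel $\kappa_{++}$ on $\mathbb{R}^k$ for a positive diagonal $k\times k$ matrix $\boldsymbol{E}$ (here $k=n-p$, $\boldsymbol{E}=\mathrm{diag}(d_{i_1},\dots,d_{i_{n-p}})$): $$\kappa_{++}(t_0,\boldsymbol{y},t,\boldsymbol{z})=\frac{(\det(\boldsymbol{M}_{tt_0}))^{1/4}}{(2\pi)^{k/2}\sqrt{\det\left(\sinh(2(t-t_0)\sqrt{\boldsymbol{E}})\right)}}\exp\left(-\frac12\begin{pmatrix}\boldsymbol{y}^{\top}&\boldsymbol{z}^{\top}\end{pmatrix}\boldsymbol{M}_{tt_0}\begin{pmatrix}\boldsymbol{y}\\ \boldsymbol{z}\end{pmatrix}\right),$$ $$\boldsymbol{M}_{tt_0}=\begin{bmatrix}\sqrt{\boldsymbol{E}}\coth\left(2(t-t_0)\sqrt{\boldsymbol{E}}\right)&-\sqrt{\boldsymbol{E}}\,\mathrm{csch}\left(2(t-t_0)\sqrt{\boldsymbol{E}}\right)\\-\sqrt{\boldsymbol{E}}\,\mathrm{csch}\left(2(t-t_0)\sqrt{\boldsymbol{E}}\right)&\sqrt{\boldsymbol{E}}\coth\left(2(t-t_0)\sqrt{\boldsymbol{E}}\right)\end{bmatrix},$$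 where a scalar function applied to a diagonal matrix means the diagonal matrix obtained by applying it to each diagonal entry, $\mathrm{csch}=1/\sinh$ and $\coth=\cosh/\sinh$.
   Formalization: Uniqueness fails with no growth class (Tychonoff), so solutions are classical, continuous up to t_0 and bounded by C exp(a|y|^2) on bounded time intervals; the initial condition is assumed continuous with such a bound, and the integral absolutely convergent for all t > t_0. *)

theory Defs
  imports "HOL-Analysis.Analysis" "Jordan_Normal_Form.Determinant"
begin

text \<open>
  The ambient space is the type \<open>real ^ 'n\<close>. The two kernels live on spaces whose dimensions
  \<open>n - p\<close> and \<open>p\<close> depend on the matrix \<open>D\<close> (and \<open>p = 0\<close> is allowed), so they are
  defined on the vectors and matrices of \<open>Jordan_Normal_Form\<close>, which carry their dimension as a
  natural number (and are indexed from 0).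
\<close>

definition coth :: "real \<Rightarrow> real" where
  "coth x = cosh x / sinh x"

definition csch :: "real \<Rightarrow> real" where
  "csch x = 1 / sinh x"

text \<open>A scalar function applied to a diagonal matrix, entry by entry along the diagonal.\<close>

definition diag_fun :: "(real \<Rightarrow> real) \<Rightarrow> real Matrix.mat \<Rightarrow> real Matrix.mat" where
  "diag_fun f E = mat_diag (dim_row E) (\<lambda>k. f (E $$ (k, k)))"

definition heat_kernel ::
    "real \<Rightarrow> real Matrix.vec \<Rightarrow> real \<Rightarrow> real Matrix.vec \<Rightarrow> real" where
  "heat_kernel t0 y t z =
     (4 * pi * (t - t0)) powr (- (real (dim_vec y) / 2)) *
     exp (- (scalar_prod (y - z) (y - z) / (4 * (t - t0))))"

definition kernel_mat :: "real Matrix.mat \<Rightarrow> real \<Rightarrow> real \<Rightarrow> real Matrix.mat" where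
  "kernel_mat E t0 t =
     (let S = diag_fun sqrt E;
          A = S * diag_fun coth ((2 * (t - t0)) \<cdot>\<^sub>m S);
          B = S * diag_fun csch ((2 * (t - t0)) \<cdot>\<^sub>m S)
      in four_block_mat A (- B) (- B) A)"

definition kernel_pp ::
    "real Matrix.mat \<Rightarrow> real \<Rightarrow> real Matrix.vec \<Rightarrow> real \<Rightarrow> real Matrix.vec \<Rightarrow> real" where
  "kernel_pp E t0 y t z =
     (let M = kernel_mat E t0 t in
      (Determinant.det M) powr (1 / 4) /
      ((2 * pi) powr (real (dim_row E) / 2) *
       sqrt (Determinant.det (diag_fun sinh ((2 * (t - t0)) \<cdot>\<^sub>m diag_fun sqrt E)))) *
      exp (- (1 / 2) * scalar_prod (y @\<^sub>v z) (M *\<^sub>v (y @\<^sub>v z))))"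

text \<open>
  The sub-vector of \<open>x\<close> with entries \<open>x\<close> at \<open>i r, i (r + 1), ..., i s\<close>; the indices
  \<open>i\<close> are numbered from 1. It is 0-dimensional if \<open>s < r\<close>.
\<close>

definition subvec :: "real ^ 'n \<Rightarrow> (nat \<Rightarrow> 'n) \<Rightarrow> nat \<Rightarrow> nat \<Rightarrow> real Matrix.vec" where
  "subvec x i r s = Matrix.vec (s + 1 - r) (\<lambda>k. vec_nth x (i (r + k)))"

definition kernel_plus ::
    "real ^ 'n \<Rightarrow> (nat \<Rightarrow> 'n) \<Rightarrow> nat \<Rightarrow> real \<Rightarrow> real ^ 'n \<Rightarrow> real \<Rightarrow> real ^ 'n \<Rightarrow> real" where
  "kernel_plus d i p t0 y t z =
     (let n = CARD('n);
          E = mat_diag (n - p) (vec_index (subvec d i 1 (n - p)))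
      in kernel_pp E t0 (subvec y i 1 (n - p)) t (subvec z i 1 (n - p)) *
         heat_kernel t0 (subvec y i (n - p + 1) n) t (subvec z i (n - p + 1) n))"

definition diagonal :: "real ^ 'n \<Rightarrow> real ^ 'n ^ 'n" where
  "diagonal d = (\<chi> k l. if k = l then vec_nth d k else 0)"

definition partially_differentiable :: "'n \<Rightarrow> (real ^ 'n \<Rightarrow> real) \<Rightarrow> real ^ 'n \<Rightarrow> bool" where
  "partially_differentiable k f y \<longleftrightarrow> (\<lambda>s. f (y + s *\<^sub>R axis k 1)) differentiable (at 0)"

definition partial :: "'n \<Rightarrow> (real ^ 'n \<Rightarrow> real) \<Rightarrow> real ^ 'n \<Rightarrow> real" where
  "partial k f y = deriv (\<lambda>s. f (y + s *\<^sub>R axis k 1)) 0"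

definition laplacian :: "(real ^ 'n \<Rightarrow> real) \<Rightarrow> real ^ 'n \<Rightarrow> real" where
  "laplacian f y = (\<Sum>k\<in>UNIV. partial k (partial k f) y)"

text \<open>Once continuously differentiable in time and twice in space, for times after \<open>t0\<close>.\<close>

definition C12 :: "real \<Rightarrow> (real \<Rightarrow> real ^ 'n \<Rightarrow> real) \<Rightarrow> bool" where
  "C12 t0 u \<longleftrightarrow>
     (\<forall>t>t0. \<forall>y.
        (\<lambda>s. u s y) differentiable (at t) \<and>
        (\<forall>k. partially_differentiable k (u t) y) \<and>
        (\<forall>k l. partially_differentiable l (partial k (u t)) y)) \<and>
     continuous_on ({t0<..} \<times> UNIV) (\<lambda>(t, y). deriv (\<lambda>s. u s y) t) \<and>
     (\<forall>k. continuous_on ({t0<..} \<times> UNIV) (\<lambda>(t, y). partial k (u t) y)) \<and>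
     (\<forall>k l. continuous_on ({t0<..} \<times> UNIV) (\<lambda>(t, y). partial l (partial k (u t)) y))"

text \<open>
  Classical solutions of the Cauchy problem
  \<open>\<partial>u/\<partial>t = \<Delta> u - (y\<^sup>T D y) u\<close>, \<open>u(t0, y) = u0(y)\<close>, on \<open>[t0, \<infinity>) \<times> \<real>\<^sup>n\<close>.
  Without a restriction at spatial infinity they need not be unique (already for the heat equation,
  by Tychonoff's example), so the last clause imposes the usual Tychonoff growth condition, with
  constants that may depend on the time horizon. Values of \<open>u\<close> at times before
  \<open>t0\<close> are irrelevant.
\<close>

definition cauchy_solution ::
    "real ^ 'n ^ 'n \<Rightarrow> real \<Rightarrow> (real ^ 'n \<Rightarrow> real) \<Rightarrow> (real \<Rightarrow> real ^ 'n \<Rightarrow> real) \<Rightarrow> bool" where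
  "cauchy_solution D t0 u0 u \<longleftrightarrow>
     continuous_on ({t0..} \<times> UNIV) (\<lambda>(t, y). u t y) \<and>
     C12 t0 u \<and>
     (\<forall>t>t0. \<forall>y. deriv (\<lambda>s. u s y) t =
                   laplacian (u t) y - inner y (D *v y) * u t y) \<and>
     (\<forall>y. u t0 y = u0 y) \<and>
     (\<forall>T\<ge>t0. \<exists>C a. \<forall>t\<in>{t0..T}. \<forall>y. \<bar>u t y\<bar> \<le> C * exp (a * (norm y)\<^sup>2))"

end

theory Submission
  imports Defs "HOL-Probability.Probability"
begin

text \<open>
  The potential is a sum over the coordinates, so the kernel is a product of one-dimensional kernels.
  In the coordinate \<open>k\<close> with \<open>d = d\<^sub>k\<close>, at elapsed time \<open>\<tau> = t - t0\<close>, its logarithm is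
  \<open>ln (B / (2 \<pi>)) / 2 + B y z - A (y\<^sup>2 + z\<^sup>2) / 2\<close> with \<open>A = \<surd>d coth (2 \<tau> \<surd>d)\<close> and
  \<open>B = \<surd>d csch (2 \<tau> \<surd>d)\<close> (Mehler's formula). In the limit \<open>d = 0\<close> both coefficients become
  \<open>1 / (2 \<tau>)\<close> and the formula becomes that of the heat kernel, so that
  \<open>kernel_plus_eq_mehler_kernel\<close> replaces the matrix formulas by a single product in which zero and
  positive \<open>d\<^sub>k\<close> play the same role. For positive times, what matters about \<open>A\<close> and \<open>B\<close> is that
  they are positive and satisfy \<open>A' = - 2 B\<^sup>2\<close>, \<open>B' = - 2 A B\<close> and \<open>A\<^sup>2 = d + B\<^sup>2\<close>;
  the identities together say that the kernel solves the equation in \<open>(\<tau>, y)\<close> for each \<open>z\<close> (\<open>log_mehler_derivative_time\<close>).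

  Existence needs three further facts.
  \<^item> Derivatives may be taken under the integral. As \<open>A\<close> decreases strictly in time, the kernel at
    times up to \<open>\<tau>2\<close>, even multiplied by \<open>exp (m |z|)\<close>, is dominated, uniformly for bounded
    \<open>y\<close>, by a multiple of the kernel at a later time with \<open>y = 0\<close> (\<open>mehler_kernel_dominated\<close>). Integrability of the kernel against
    the initial value at all times thus provides the majorants, and all derivatives up to the order
    considered are the kernel times a polynomial in \<open>z\<close>.
  \<^item> The initial value is attained. Completing the square, the one-dimensional kernel is
    \<open>exp (- (A - B) (y\<^sup>2 + z\<^sup>2) / 2)\<close> times the normal density in \<open>z\<close> with mean \<open>y\<close> and
    variance \<open>1 / B\<close>. The substitution \<open>z = y + w / \<surd>B\<close> gives an integral against a fixed
    Gaussian whose integrand is continuous up to \<open>\<tau> = 0\<close>, as \<open>1 / B\<close> and \<open>A - B\<close> tend to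
    \<open>0\<close> (\<open>integral_kernel_eq_rescaled\<close>, \<open>continuous_on_solution\<close>).
  \<^item> The growth bound on \<open>[t0, T]\<close> comes from the Gaussian form for small times and from the
    domination by a later kernel for the others (\<open>solution_growth\<close>).

  Uniqueness is the maximum principle under Tychonoff's growth condition. On a time interval whose
  length depends only on the growth rate there is an explicit supersolution that outgrows
  the difference of two solutions at infinity (\<open>barrier_supersolution\<close>); since the potential is
  nonnegative, the difference minus a small multiple of that supersolution cannot have a positive
  maximum (\<open>cauchy_solution_comparison_short\<close>). Finitely many such intervals cover \<open>[t0, T]\<close>.
\<close>

section \<open>The coefficients of Mehler's formula\<close>

no_notation scalar_prod (infix "\<bullet>" 70)

text \<open>
  The case distinction is the continuous extension to \<open>d = 0\<close>. At \<open>\<tau> = 0\<close> both coefficients are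
  \<open>0\<close>, because division by zero yields \<open>0\<close>.
\<close>

definition mehler_A :: "real \<Rightarrow> real \<Rightarrow> real" where
  "mehler_A d \<tau> = (if d = 0 then 1 / (2 * \<tau>) else sqrt d * coth (2 * \<tau> * sqrt d))"

definition mehler_B :: "real \<Rightarrow> real \<Rightarrow> real" where
  "mehler_B d \<tau> = (if d = 0 then 1 / (2 * \<tau>) else sqrt d * csch (2 * \<tau> * sqrt d))"

lemma mehler_B_pos: "d \<ge> 0 \<Longrightarrow> \<tau> > 0 \<Longrightarrow> mehler_B d \<tau> > 0"
  by (auto simp: mehler_B_def csch_def)

lemma mehler_A_pos: "d \<ge> 0 \<Longrightarrow> \<tau> > 0 \<Longrightarrow> mehler_A d \<tau> > 0"
  by (auto simp: mehler_A_def coth_def)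

lemma mehler_A_square:
  assumes "d \<ge> 0" "\<tau> > 0"
  shows "(mehler_A d \<tau>)\<^sup>2 = d + (mehler_B d \<tau>)\<^sup>2"
proof (cases "d = 0")
  case False
  define s where "s = 2 * \<tau> * sqrt d"
  have "sinh s \<noteq> 0" using assms False by (simp add: s_def)
  moreover have "(cosh s)\<^sup>2 = (sinh s)\<^sup>2 + 1" by (simp add: cosh_square_eq)
  ultimately have "(coth s)\<^sup>2 = 1 + (csch s)\<^sup>2"
    by (simp add: coth_def csch_def field_simps)
  then show ?thesis
    using False assms by (simp add: mehler_A_def mehler_B_def power_mult_distrib distrib_left flip: s_def)
qed (simp add: mehler_A_def mehler_B_def)

lemma mehler_A_has_real_derivative:
  assumes "d \<ge> 0" "\<tau> > 0"
  shows "(mehler_A d has_real_derivative - 2 * (mehler_B d \<tau>)\<^sup>2) (at \<tau>)"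
proof (cases "d = 0")
  case True
  have "((\<lambda>\<tau>. 1 / (2 * \<tau>)) has_real_derivative - 2 * (1 / (2 * \<tau>))\<^sup>2) (at \<tau>)"
    using assms by (auto intro!: derivative_eq_intros simp: power2_eq_square field_simps)
  then show ?thesis using True by (simp add: mehler_A_def[abs_def] mehler_B_def)
next
  case False
  define c where "c = sqrt d"
  define s where "s = 2 * \<tau> * c"
  have s: "sinh s \<noteq> 0" using assms False by (simp add: s_def c_def)
  then have "((\<lambda>\<tau>. c * (cosh (2 * \<tau> * c) / sinh (2 * \<tau> * c)))
      has_real_derivative c * ((sinh s * (2 * c) * sinh s - cosh s * (cosh s * (2 * c))) / (sinh s * sinh s))) (at \<tau>)"
    unfolding s_def by (auto intro!: derivative_eq_intros simp: algebra_simps)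
  moreover have "c * ((sinh s * (2 * c) * sinh s - cosh s * (cosh s * (2 * c))) / (sinh s * sinh s))
     = - 2 * (c * csch s)\<^sup>2 * ((cosh s)\<^sup>2 - (sinh s)\<^sup>2)"
    using s by (simp add: csch_def field_simps power2_eq_square)
  ultimately have "((\<lambda>\<tau>. c * coth (2 * \<tau> * c)) has_real_derivative - 2 * (c * csch s)\<^sup>2) (at \<tau>)"
    by (simp add: coth_def cosh_square_eq)
  then show ?thesis using False
    by (simp add: mehler_A_def[abs_def] mehler_B_def c_def s_def)
qed

lemma mehler_B_has_real_derivative:
  assumes "d \<ge> 0" "\<tau> > 0"
  shows "(mehler_B d has_real_derivative - 2 * mehler_A d \<tau> * mehler_B d \<tau>) (at \<tau>)"
proof (cases "d = 0")
  case True
  have "((\<lambda>\<tau>. 1 / (2 * \<tau>)) has_real_derivative - 2 * (1 / (2 * \<tau>)) * (1 / (2 * \<tau>))) (at \<tau>)"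
    using assms by (auto intro!: derivative_eq_intros simp: power2_eq_square field_simps)
  then show ?thesis using True by (simp add: mehler_A_def mehler_B_def[abs_def])
next
  case False
  define c where "c = sqrt d"
  define s where "s = 2 * \<tau> * c"
  have s: "sinh s \<noteq> 0" using assms False by (simp add: s_def c_def)
  then have "((\<lambda>\<tau>. c * csch (2 * \<tau> * c))
      has_real_derivative c * (- (cosh s * (2 * c)) / (sinh s * sinh s))) (at \<tau>)"
    unfolding s_def csch_def by (auto intro!: derivative_eq_intros)
  moreover have "c * (- (cosh s * (2 * c)) / (sinh s * sinh s)) = - 2 * (c * coth s) * (c * csch s)"
    by (simp add: csch_def coth_def)
  ultimately show ?thesis using False
    by (simp add: mehler_B_def[abs_def] mehler_A_def c_def s_def)
qed

lemma mehler_A_strict_antimono: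
  assumes "d \<ge> 0" "0 < \<tau>" "\<tau> < \<tau>'"
  shows "mehler_A d \<tau>' < mehler_A d \<tau>"
proof (rule DERIV_neg_imp_decreasing[OF assms(3)])
  fix x assume "\<tau> \<le> x"
  then have "x > 0" using assms by simp
  then show "\<exists>y. (mehler_A d has_real_derivative y) (at x) \<and> y < 0"
    using mehler_A_has_real_derivative[OF assms(1)] mehler_B_pos[OF assms(1), of x] by fastforce
qed

lemma mehler_B_antimono:
  assumes "d \<ge> 0" "0 < \<tau>" "\<tau> \<le> \<tau>'"
  shows "mehler_B d \<tau>' \<le> mehler_B d \<tau>"
proof (rule DERIV_nonpos_imp_nonincreasing[OF assms(3)])
  fix x assume "\<tau> \<le> x"
  then have "x > 0" using assms by simp
  then show "\<exists>y. (mehler_B d has_real_derivative y) (at x) \<and> y \<le> 0"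
    using mehler_B_has_real_derivative[OF assms(1)] mehler_B_pos[OF assms(1), of x]
      mehler_A_pos[OF assms(1), of x]
    by (intro exI conjI) auto
qed

lemma continuous_on_mehler_A [continuous_intros]:
  assumes "d \<ge> 0" "continuous_on S f" "\<And>x. x \<in> S \<Longrightarrow> f x > 0"
  shows "continuous_on S (\<lambda>x. mehler_A d (f x))"
proof -
  have "continuous_on {0<..} (mehler_A d)"
    using DERIV_isCont[OF mehler_A_has_real_derivative[OF assms(1)]]
    by (intro continuous_at_imp_continuous_on) auto
  from continuous_on_compose2[OF this assms(2)] show ?thesis using assms(3) by auto
qed

lemma continuous_on_mehler_B [continuous_intros]:
  assumes "d \<ge> 0" "continuous_on S f" "\<And>x. x \<in> S \<Longrightarrow> f x > 0"
  shows "continuous_on S (\<lambda>x. mehler_B d (f x))"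
proof -
  have "continuous_on {0<..} (mehler_B d)"
    using DERIV_isCont[OF mehler_B_has_real_derivative[OF assms(1)]]
    by (intro continuous_at_imp_continuous_on) auto
  from continuous_on_compose2[OF this assms(2)] show ?thesis using assms(3) by auto
qed

text \<open>
  The variance of the Gaussian factor of the kernel. The default value \<open>1 / 0 = 0\<close> is its limit at
  time \<open>0\<close>, so the formula on the right also holds there; the same is true of the damping
  \<open>A - B\<close> below.
\<close>

lemma mehler_variance_eq:
  assumes "d \<ge> 0" "\<tau> \<ge> 0"
  shows "1 / mehler_B d \<tau> = (if d = 0 then 2 * \<tau> else sinh (2 * \<tau> * sqrt d) / sqrt d)"
  using assms by (auto simp: mehler_B_def csch_def)

lemma mehler_damping_eq:
  assumes "d \<ge> 0" "\<tau> \<ge> 0"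
  shows "mehler_A d \<tau> - mehler_B d \<tau> = sqrt d * tanh (\<tau> * sqrt d)"
proof (cases "d = 0 \<or> \<tau> = 0")
  case False
  define s where "s = \<tau> * sqrt d"
  have s: "sinh s \<noteq> 0" "cosh s \<noteq> 0" using assms False by (auto simp: s_def)
  have s2: "2 * \<tau> * sqrt d = 2 * s" by (simp add: s_def)
  have cosh: "cosh (2 * s) - 1 = 2 * (sinh s)\<^sup>2" by (simp add: cosh_double cosh_square_eq)
  have "mehler_A d \<tau> - mehler_B d \<tau> = sqrt d * ((cosh (2 * s) - 1) / (2 * sinh s * cosh s))"
    using False unfolding mehler_A_def mehler_B_def coth_def csch_def s2 sinh_double
    by (simp add: diff_divide_distrib right_diff_distrib)
  also have "\<dots> = sqrt d * tanh s"
    unfolding cosh using s by (simp add: tanh_def power2_eq_square)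
  finally show ?thesis by (simp add: s_def)
qed (auto simp: mehler_A_def mehler_B_def coth_def csch_def)

section \<open>The kernel as a product over the coordinates\<close>

definition log_mehler :: "real \<Rightarrow> real \<Rightarrow> real \<Rightarrow> real \<Rightarrow> real" where
  "log_mehler d \<tau> y z = ln (mehler_B d \<tau> / (2 * pi)) / 2
     + mehler_B d \<tau> * y * z - mehler_A d \<tau> * (y\<^sup>2 + z\<^sup>2) / 2"

lemma heat_kernel_eq:
  assumes "t > t0" "dim_vec y = N" "dim_vec z = N"
  shows "heat_kernel t0 y t z = exp (\<Sum>k<N. log_mehler 0 (t - t0) (vec_index y k) (vec_index z k))"
proof -
  define \<tau> where "\<tau> = t - t0"
  have p: "\<tau> > 0" using assms by (simp add: \<tau>_def)
  have "log_mehler 0 \<tau> a b = - (1/2) * ln (4 * pi * \<tau>) - (a - b)\<^sup>2 / (4 * \<tau>)" for a b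
    using p by (simp add: log_mehler_def mehler_A_def mehler_B_def ln_div ln_mult field_simps power2_eq_square)
  then have "(\<Sum>k<N. log_mehler 0 \<tau> (vec_index y k) (vec_index z k))
     = - (real N / 2) * ln (4 * pi * \<tau>) + - (scalar_prod (y - z) (y - z) / (4 * \<tau>))"
    using assms by (simp add: scalar_prod_def sum_subtractf sum_divide_distrib power2_eq_square atLeast0LessThan)
  then show ?thesis using p assms unfolding heat_kernel_def \<tau>_def[symmetric]
    by (simp only: exp_add powr_def) simp
qed

lemma det_mat_diag: "Determinant.det (mat_diag N (f :: nat \<Rightarrow> real)) = (\<Prod>k<N. f k)"
proof -
  have "upper_triangular (mat_diag N f)" by (auto simp: mat_diag_def)
  moreover have "diag_mat (mat_diag N f) = map f [0..<N]"
    by (auto simp: diag_mat_def mat_diag_def)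
  ultimately show ?thesis
    by (simp add: det_upper_triangular[OF _ mat_diag_dim] prod.list_conv_set_nth atLeast0LessThan)
qed

lemma diag_fun_mat_diag: "diag_fun f (mat_diag N q) = mat_diag N (\<lambda>k. f (q k))"
  by (auto simp: diag_fun_def mat_diag_def)

lemma smult_mat_diag: "c \<cdot>\<^sub>m mat_diag N q = mat_diag N (\<lambda>k. c * q k :: real)"
  by (auto simp: mat_diag_def)

lemma scalar_prod_mat_diag:
  assumes "y \<in> carrier_vec N" "z \<in> carrier_vec N"
  shows "scalar_prod y (mat_diag N q *\<^sub>v z) = (\<Sum>k<N. q k * vec_index y k * vec_index z k :: real)"
proof -
  have "vec_index (mat_diag N q *\<^sub>v z) k = q k * vec_index z k" if "k < N" for k
    using assms that by (simp add: mat_diag_def scalar_prod_def if_distrib[of "\<lambda>x. x * _"] cong: if_cong)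
  moreover have "dim_vec (mat_diag N q *\<^sub>v z) = N" by (simp add: mat_diag_def)
  ultimately show ?thesis
    by (simp add: scalar_prod_def atLeast0LessThan mult_ac)
qed

text \<open>
  All blocks of \<open>kernel_mat\<close> are diagonal, so they commute and its determinant is that of
  \<open>A\<^sup>2 - B\<^sup>2 = E\<close>. Hence the fourth root in the prefactor is that of the product of the \<open>q k\<close>, and
  \<open>\<surd>q / sinh\<close> is \<open>B\<close>.
\<close>

lemma kernel_pp_eq:
  assumes "t > t0" "\<And>k. k < N \<Longrightarrow> q k > 0" "y \<in> carrier_vec N" "z \<in> carrier_vec N"
  shows "kernel_pp (mat_diag N q) t0 y t z =
    exp (\<Sum>k<N. log_mehler (q k) (t - t0) (vec_index y k) (vec_index z k))"
proof -
  let ?\<tau> = "t - t0"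
  have p: "?\<tau> > 0" using assms by simp
  define a where "a k = sqrt (q k) * coth (2 * ?\<tau> * sqrt (q k))" for k
  define b where "b k = sqrt (q k) * csch (2 * ?\<tau> * sqrt (q k))" for k
  define sh where "sh k = sinh (2 * ?\<tau> * sqrt (q k))" for k
  have a: "mehler_A (q k) ?\<tau> = a k" and b: "mehler_B (q k) ?\<tau> = b k" if "k < N" for k
    using assms(2)[OF that] by (auto simp: a_def b_def mehler_A_def mehler_B_def)
  have M: "kernel_mat (mat_diag N q) t0 t =
      four_block_mat (mat_diag N a) (mat_diag N (\<lambda>k. - b k)) (mat_diag N (\<lambda>k. - b k)) (mat_diag N a)"
  proof -
    have "- mat_diag N b = mat_diag N (\<lambda>k. - b k)" by (auto simp: mat_diag_def)
    then show ?thesis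
      by (simp add: kernel_mat_def Let_def diag_fun_mat_diag smult_mat_diag a_def[abs_def] b_def[abs_def])
  qed
  have "mat_diag N a * mat_diag N a - mat_diag N (\<lambda>k. - b k) * mat_diag N (\<lambda>k. - b k)
      = mat_diag N (\<lambda>k. a k * a k - b k * b k)"
    by (simp add: mat_diag_diag) (auto simp: mat_diag_def)
  moreover have "mat_diag N (\<lambda>k. - b k) * mat_diag N a = mat_diag N a * mat_diag N (\<lambda>k. - b k)"
    by (simp add: mult.commute)
  ultimately have "Determinant.det (kernel_mat (mat_diag N q) t0 t) = (\<Prod>k<N. a k * a k - b k * b k)"
    unfolding M by (subst det_four_block_mat[where n = N]) (simp_all add: det_mat_diag)
  also have "\<dots> = (\<Prod>k<N. q k)"
  proof (intro prod.cong refl)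
    fix k assume "k \<in> {..<N}"
    then show "a k * a k - b k * b k = q k"
      using mehler_A_square[OF less_imp_le[OF assms(2)] p, of k] by (simp add: a b power2_eq_square)
  qed
  finally have detM: "Determinant.det (kernel_mat (mat_diag N q) t0 t) = (\<Prod>k<N. q k)" .
  have detS: "Determinant.det (diag_fun sinh ((2 * ?\<tau>) \<cdot>\<^sub>m diag_fun sqrt (mat_diag N q))) = (\<Prod>k<N. sh k)"
    by (simp add: diag_fun_mat_diag smult_mat_diag det_mat_diag sh_def)
  have quad: "scalar_prod (y @\<^sub>v z) (kernel_mat (mat_diag N q) t0 t *\<^sub>v (y @\<^sub>v z))
     = (\<Sum>k<N. a k * ((vec_index y k)\<^sup>2 + (vec_index z k)\<^sup>2) - 2 * b k * vec_index y k * vec_index z k)"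
  proof -
    have c: "mat_diag N f *\<^sub>v v \<in> carrier_vec N" if "v \<in> carrier_vec N" for f :: "nat \<Rightarrow> real" and v
      by (rule mult_mat_vec_carrier[OF mat_diag_dim that])
    have v: "kernel_mat (mat_diag N q) t0 t *\<^sub>v (y @\<^sub>v z) =
        (mat_diag N a *\<^sub>v y + mat_diag N (\<lambda>k. - b k) *\<^sub>v z) @\<^sub>v
        (mat_diag N (\<lambda>k. - b k) *\<^sub>v y + mat_diag N a *\<^sub>v z)"
      unfolding M
      by (rule four_block_mat_mult_vec[OF mat_diag_dim mat_diag_dim mat_diag_dim mat_diag_dim assms(3,4)])
    have "scalar_prod (y @\<^sub>v z) (kernel_mat (mat_diag N q) t0 t *\<^sub>v (y @\<^sub>v z)) =
        scalar_prod y (mat_diag N a *\<^sub>v y + mat_diag N (\<lambda>k. - b k) *\<^sub>v z) +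
        scalar_prod z (mat_diag N (\<lambda>k. - b k) *\<^sub>v y + mat_diag N a *\<^sub>v z)"
      unfolding v
      by (rule scalar_prod_append[OF assms(3,4) add_carrier_vec add_carrier_vec]) (rule c assms(3,4))+
    also have "\<dots> = (\<Sum>k<N. a k * vec_index y k * vec_index y k) + (\<Sum>k<N. - b k * vec_index y k * vec_index z k) +
       ((\<Sum>k<N. - b k * vec_index z k * vec_index y k) + (\<Sum>k<N. a k * vec_index z k * vec_index z k))"
      using assms(3,4) c
      by (simp only: scalar_prod_add_distrib[of _ N] scalar_prod_mat_diag)
    also have "\<dots> = (\<Sum>k<N. a k * ((vec_index y k)\<^sup>2 + (vec_index z k)\<^sup>2) - 2 * b k * vec_index y k * vec_index z k)"
      unfolding sum.distrib[symmetric]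
      by (intro sum.cong refl) (simp add: power2_eq_square algebra_simps)
    finally show ?thesis .
  qed
  have pre: "(\<Prod>k<N. q k) powr (1 / 4) / ((2 * pi) powr (real N / 2) * sqrt (\<Prod>k<N. sh k))
     = exp (\<Sum>k<N. ln (b k / (2 * pi)) / 2)"
  proof -
    have shp: "sh k > 0" if "k < N" for k using assms(2)[OF that] p by (simp add: sh_def)
    have "ln (b k / (2 * pi)) / 2 = ln (q k) / 4 - (ln (2 * pi) / 2 + ln (sh k) / 2)" if "k < N" for k
    proof -
      have "b k = sqrt (q k) / sh k" by (simp add: b_def csch_def sh_def)
      then show ?thesis
        using assms(2)[OF that] shp[OF that] by (simp add: ln_div ln_mult ln_sqrt) (simp add: field_simps)
    qed
    then have "(\<Sum>k<N. ln (b k / (2 * pi)) / 2) = (\<Sum>k<N. ln (q k) / 4 - (ln (2 * pi) / 2 + ln (sh k) / 2))"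
      by (intro sum.cong) auto
    then have "exp (\<Sum>k<N. ln (b k / (2 * pi)) / 2)
       = exp ((\<Sum>k<N. ln (q k)) / 4 - ((real N / 2) * ln (2 * pi) + (\<Sum>k<N. ln (sh k)) / 2))"
      by (simp add: sum_subtractf sum.distrib sum_divide_distrib)
    moreover have "(\<Prod>k<N. q k) powr (1 / 4) = exp ((\<Sum>k<N. ln (q k)) / 4)"
    proof -
      have "(\<Prod>k<N. q k) = exp (\<Sum>k<N. ln (q k))" using assms(2) by (simp add: exp_sum)
      then show ?thesis by (simp add: powr_def)
    qed
    moreover have "sqrt (\<Prod>k<N. sh k) = exp ((\<Sum>k<N. ln (sh k)) / 2)"
    proof -
      have "exp ((\<Sum>k<N. ln (sh k)) / 2) ^ 2 = exp (\<Sum>k<N. ln (sh k))"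
        by (simp flip: exp_double)
      also have "\<dots> = (\<Prod>k<N. sh k)" using shp by (simp add: exp_sum)
      finally show ?thesis by (metis exp_ge_zero real_sqrt_unique)
    qed
    moreover have "(2 * pi) powr (real N / 2) = exp ((real N / 2) * ln (2 * pi))"
      by (simp add: powr_def)
    ultimately show ?thesis by (simp only: exp_diff exp_add)
  qed
  have "dim_row (mat_diag N q) = N" by (simp add: mat_diag_def)
  then have "kernel_pp (mat_diag N q) t0 y t z = exp (\<Sum>k<N. ln (b k / (2 * pi)) / 2) *
     exp (- (1 / 2) * (\<Sum>k<N. a k * ((vec_index y k)\<^sup>2 + (vec_index z k)\<^sup>2) - 2 * b k * vec_index y k * vec_index z k))"
    unfolding kernel_pp_def Let_def detM detS quad by (simp only: pre)
  also have "\<dots> = exp (\<Sum>k<N. log_mehler (q k) ?\<tau> (vec_index y k) (vec_index z k))"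
    unfolding exp_add[symmetric] sum_distrib_left sum.distrib[symmetric]
    by (intro arg_cong[where f = exp] sum.cong) (auto simp: log_mehler_def a b field_simps)
  finally show ?thesis .
qed

(* from here on vectors are elements of real ^ 'n *)
no_notation vec_index (infixl "$" 100)

definition mehler_kernel :: "real ^ 'n \<Rightarrow> real \<Rightarrow> real ^ 'n \<Rightarrow> real ^ 'n \<Rightarrow> real" where
  "mehler_kernel d \<tau> y z = exp (\<Sum>k\<in>UNIV. log_mehler (d $ k) \<tau> (y $ k) (z $ k))"

lemma kernel_plus_eq_mehler_kernel:
  fixes d :: "real ^ 'n"
  assumes n: "n = CARD('n)" and p: "p \<le> n"
    and pos: "bij_betw i {1..n - p} {k. d $ k > 0}"
    and zero: "bij_betw i {n - p + 1..n} {k. d $ k = 0}"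
    and nonneg: "\<And>k. d $ k \<ge> 0"
    and t: "t > t0"
  shows "kernel_plus d i p t0 y t z = mehler_kernel d (t - t0) y z"
proof -
  let ?N = "n - p" and ?f = "\<lambda>k. log_mehler (d $ k) (t - t0) (y $ k) (z $ k)"
  have s1: "bij_betw (\<lambda>k. 1 + k) {..<?N} {1..?N}"
    by (rule bij_betw_byWitness[where f' = "\<lambda>k. k - 1"]) auto
  have b1: "bij_betw (\<lambda>k. i (1 + k)) {..<?N} {k. d $ k > 0}"
    by (rule bij_betw_trans[OF s1 pos, unfolded comp_def])
  have s2: "bij_betw (\<lambda>k. ?N + 1 + k) {..<p} {?N + 1..n}"
    by (rule bij_betw_byWitness[where f' = "\<lambda>k. k - (?N + 1)"]) (use p in auto)
  have b2: "bij_betw (\<lambda>k. i (?N + 1 + k)) {..<p} {k. d $ k = 0}"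
    by (rule bij_betw_trans[OF s2 zero, unfolded comp_def])
  have pos': "d $ i (1 + k) > 0" if "k < ?N" for k
    using bij_betw_apply[OF b1, of k] that by auto
  have zero': "d $ i (?N + 1 + k) = 0" if "k < p" for k
    using bij_betw_apply[OF b2, of k] that by auto
  have E: "mat_diag ?N (vec_index (subvec d i 1 ?N)) = mat_diag ?N (\<lambda>k. d $ i (1 + k))"
    by (auto simp: mat_diag_def subvec_def)
  have "kernel_pp (mat_diag ?N (\<lambda>k. d $ i (1 + k))) t0 (subvec y i 1 ?N) t (subvec z i 1 ?N)
      = exp (\<Sum>k<?N. ?f (i (1 + k)))"
    by (subst kernel_pp_eq[OF t pos']) (auto simp: subvec_def intro!: sum.cong)
  also have "(\<Sum>k<?N. ?f (i (1 + k))) = sum ?f {k. d $ k > 0}"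
    by (rule sum.reindex_bij_betw[OF b1])
  finally have 1: "kernel_pp (mat_diag ?N (\<lambda>k. d $ i (1 + k))) t0 (subvec y i 1 ?N) t (subvec z i 1 ?N)
      = exp (sum ?f {k. d $ k > 0})" .
  have "heat_kernel t0 (subvec y i (?N + 1) n) t (subvec z i (?N + 1) n)
      = exp (\<Sum>k<p. ?f (i (?N + 1 + k)))"
  proof (subst heat_kernel_eq[OF t, of _ p])
    show "exp (\<Sum>k<p. log_mehler 0 (t - t0) (vec_index (subvec y i (?N + 1) n) k) (vec_index (subvec z i (?N + 1) n) k))
        = exp (\<Sum>k<p. ?f (i (?N + 1 + k)))"
    proof (intro arg_cong[where f = exp] sum.cong refl)
      fix k assume "k \<in> {..<p}"
      then have k: "k < p" "k < n + 1 - (?N + 1)" using p by auto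
      show "log_mehler 0 (t - t0) (vec_index (subvec y i (?N + 1) n) k) (vec_index (subvec z i (?N + 1) n) k)
          = ?f (i (?N + 1 + k))"
        unfolding subvec_def index_vec[OF k(2)] zero'[OF k(1)] by (rule refl)
    qed
  next
    have "n + 1 - (?N + 1) = p" using p by linarith
    then show "dim_vec (subvec y i (?N + 1) n) = p" "dim_vec (subvec z i (?N + 1) n) = p"
      unfolding subvec_def dim_vec by assumption+
  qed
  also have "(\<Sum>k<p. ?f (i (?N + 1 + k))) = sum ?f {k. d $ k = 0}"
    by (rule sum.reindex_bij_betw[OF b2])
  finally have 2: "heat_kernel t0 (subvec y i (?N + 1) n) t (subvec z i (?N + 1) n)
      = exp (sum ?f {k. d $ k = 0})" .
  have "sum ?f UNIV = sum ?f ({k. d $ k > 0} \<union> {k. d $ k = 0})"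
    using nonneg by (intro sum.cong) (auto intro: order_antisym simp: not_less)
  also have "\<dots> = sum ?f {k. d $ k > 0} + sum ?f {k. d $ k = 0}"
    by (rule sum.union_disjoint) auto
  finally have "sum ?f UNIV = sum ?f {k. d $ k > 0} + sum ?f {k. d $ k = 0}" .
  with 1 2 E show ?thesis
    unfolding kernel_plus_def Let_def mehler_kernel_def n[symmetric] by (simp only: exp_add)
qed

section \<open>Integrals depending on a parameter\<close>

lemma continuous_on_integral_dominated:
  fixes f :: "'x::metric_space \<Rightarrow> 'z \<Rightarrow> real"
  assumes meas: "\<And>x. x \<in> S \<Longrightarrow> f x \<in> borel_measurable M"
    and cont: "\<And>z. z \<in> space M \<Longrightarrow> continuous_on S (\<lambda>x. f x z)"
    and dom: "\<And>x. x \<in> S \<Longrightarrow> \<exists>e>0. \<exists>g. integrable M g \<and> (\<forall>x'\<in>S \<inter> ball x e. \<forall>z\<in>space M. \<bar>f x' z\<bar> \<le> g z)"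
  shows "continuous_on S (\<lambda>x. \<integral>z. f x z \<partial>M)"
  unfolding continuous_on_eq_continuous_within
proof (intro ballI continuous_within_sequentiallyI)
  fix x u assume x: "x \<in> S" and u: "u \<longlonglongrightarrow> x" "\<forall>n. u n \<in> S"
  obtain e g where e: "e > 0" and g: "integrable M g"
    and le: "\<And>x' z. x' \<in> S \<inter> ball x e \<Longrightarrow> z \<in> space M \<Longrightarrow> \<bar>f x' z\<bar> \<le> g z"
    using dom[OF x] by blast
  obtain N where N: "\<And>n. n \<ge> N \<Longrightarrow> u n \<in> ball x e"
    using topological_tendstoD[OF u(1) open_ball, of x e] e by (auto simp: eventually_sequentially)
  have "(\<lambda>n. \<integral>z. f (u (n + N)) z \<partial>M) \<longlonglongrightarrow> (\<integral>z. f x z \<partial>M)"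
  proof (rule integral_dominated_convergence[OF _ _ g])
    show "f x \<in> borel_measurable M" "\<And>n. f (u (n + N)) \<in> borel_measurable M"
      using meas x u by auto
    show "AE z in M. (\<lambda>n. f (u (n + N)) z) \<longlonglongrightarrow> f x z"
    proof (rule AE_I2)
      fix z assume "z \<in> space M"
      from cont[OF this] have "continuous (at x within S) (\<lambda>x. f x z)"
        using x by (simp add: continuous_on_eq_continuous_within)
      from continuous_within_tendsto_compose'[OF this _ u(1)] u(2)
      have "(\<lambda>n. f (u n) z) \<longlonglongrightarrow> f x z" by blast
      then show "(\<lambda>n. f (u (n + N)) z) \<longlonglongrightarrow> f x z" by (rule LIMSEQ_ignore_initial_segment)
    qed
    show "AE z in M. norm (f (u (n + N)) z) \<le> g z" for n
      using le[of "u (n + N)"] N[of "n + N"] u(2) by (intro AE_I2) auto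
  qed
  then show "(\<lambda>n. \<integral>z. f (u n) z \<partial>M) \<longlonglongrightarrow> (\<integral>z. f x z \<partial>M)"
    by (rule LIMSEQ_offset)
qed

text \<open>
  By the mean value theorem the majorant of the derivative also bounds the difference quotients, so
  that dominated convergence applies to them.
\<close>

lemma has_real_derivative_integral:
  fixes f f' :: "real \<Rightarrow> 'z \<Rightarrow> real"
  assumes e: "e > 0"
    and int: "\<And>s. \<bar>s - a\<bar> < e \<Longrightarrow> integrable M (f s)"
    and der: "\<And>s z. \<bar>s - a\<bar> < e \<Longrightarrow> z \<in> space M \<Longrightarrow> ((\<lambda>s. f s z) has_real_derivative f' s z) (at s)"
    and le: "\<And>s z. \<bar>s - a\<bar> < e \<Longrightarrow> z \<in> space M \<Longrightarrow> \<bar>f' s z\<bar> \<le> g z"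
    and g: "integrable M g"
    and meas: "f' a \<in> borel_measurable M"
  shows "((\<lambda>s. \<integral>z. f s z \<partial>M) has_real_derivative (\<integral>z. f' a z \<partial>M)) (at a)"
  unfolding DERIV_def tendsto_at_iff_sequentially
proof (intro allI impI)
  fix h :: "nat \<Rightarrow> real"
  assume h0: "\<forall>i. h i \<in> UNIV - {0}" and h: "h \<longlonglongrightarrow> 0"
  then obtain N where N: "\<And>n. n \<ge> N \<Longrightarrow> \<bar>h n\<bar> < e"
    using LIMSEQ_D[OF h e] by auto
  let ?q = "\<lambda>n z. (f (a + h (n + N)) z - f a z) / h (n + N)"
  have int': "integrable M (f (a + h (n + N)))" "integrable M (f a)" for n
    using int N[of "n + N"] e by auto
  have "(\<lambda>n. \<integral>z. ?q n z \<partial>M) \<longlonglongrightarrow> (\<integral>z. f' a z \<partial>M)"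
  proof (rule integral_dominated_convergence[OF meas _ g])
    show "?q n \<in> borel_measurable M" for n
      using int' by (intro borel_measurable_integrable integrable_divide) auto
    show "AE z in M. (\<lambda>n. ?q n z) \<longlonglongrightarrow> f' a z"
    proof (rule AE_I2)
      fix z assume "z \<in> space M"
      from der[OF _ this, of a] e have "(\<lambda>h. (f (a + h) z - f a z) / h) \<midarrow>0\<rightarrow> f' a z"
        by (simp add: DERIV_def)
      then have "((\<lambda>h. (f (a + h) z - f a z) / h) \<circ> h) \<longlonglongrightarrow> f' a z"
        unfolding tendsto_at_iff_sequentially using h0 h by blast
      then show "(\<lambda>n. ?q n z) \<longlonglongrightarrow> f' a z"
        unfolding comp_def by (rule LIMSEQ_ignore_initial_segment)
    qed
    show "AE z in M. norm (?q n z) \<le> g z" for n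
    proof (rule AE_I2)
      fix z assume z: "z \<in> space M"
      let ?h = "h (n + N)"
      have hn: "?h \<noteq> 0" "\<bar>?h\<bar> < e" using h0 N[of "n + N"] by auto
      have "\<bar>f (a + ?h) z - f a z\<bar> \<le> g z * \<bar>?h\<bar>"
      proof -
        have "norm (f (a + ?h) z - f a z) \<le> g z * norm (a + ?h - a)"
        proof (rule field_differentiable_bound[where S = "{a - \<bar>?h\<bar>..a + \<bar>?h\<bar>}" and f' = "\<lambda>s. f' s z"])
          show "((\<lambda>s. f s z) has_field_derivative f' s z) (at s within {a - \<bar>?h\<bar>..a + \<bar>?h\<bar>})"
            if "s \<in> {a - \<bar>?h\<bar>..a + \<bar>?h\<bar>}" for s
            using that hn z by (intro DERIV_subset[OF der]) auto
          show "norm (f' s z) \<le> g z" if "s \<in> {a - \<bar>?h\<bar>..a + \<bar>?h\<bar>}" for s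
            using that hn z le[of s z] by auto
        qed auto
        then show ?thesis by simp
      qed
      then show "norm (?q n z) \<le> g z" using hn by (simp add: divide_le_eq)
    qed
  qed
  also have "(\<lambda>n. \<integral>z. ?q n z \<partial>M) =
      (\<lambda>n. ((\<integral>z. f (a + h (n + N)) z \<partial>M) - (\<integral>z. f a z \<partial>M)) / h (n + N))"
    using int' by simp
  finally show "((\<lambda>h. ((\<integral>z. f (a + h) z \<partial>M) - (\<integral>z. f a z \<partial>M)) / h) \<circ> h) \<longlonglongrightarrow> (\<integral>z. f' a z \<partial>M)"
    unfolding comp_def by (rule LIMSEQ_offset)
qed

section \<open>Gaussian integrals and affine substitutions\<close>

lemma prod_Basis_vec: "(\<Prod>b\<in>Basis. F b) = (\<Prod>k\<in>UNIV. F (axis k 1 :: real ^ 'n))"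
proof -
  have B: "(Basis :: (real ^ 'n) set) = (\<lambda>k. axis k 1) ` UNIV"
    by (auto simp: Basis_vec_def)
  have I: "inj (\<lambda>k. axis k (1 :: real) :: real ^ 'n)"
    by (auto simp: inj_def axis_eq_axis)
  show ?thesis by (subst B, subst prod.reindex[OF I]) (simp add: comp_def)
qed

lemma sum_Basis_vec: "(\<Sum>b\<in>Basis. F b) = (\<Sum>k\<in>UNIV. F (axis k 1 :: real ^ 'n))"
proof -
  have B: "(Basis :: (real ^ 'n) set) = (\<lambda>k. axis k 1) ` UNIV"
    by (auto simp: Basis_vec_def)
  have I: "inj (\<lambda>k. axis k (1 :: real) :: real ^ 'n)"
    by (auto simp: inj_def axis_eq_axis)
  show ?thesis by (subst B, subst sum.reindex[OF I]) (simp add: comp_def)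
qed

lemma has_bochner_integral_prod_normal_density:
  assumes "\<sigma> > 0"
  shows "has_bochner_integral lborel (\<lambda>w :: real ^ 'n. \<Prod>k\<in>UNIV. normal_density 0 \<sigma> (w $ k)) 1"
proof (rule has_bochner_integral_nn_integral)
  have "(\<integral>\<^sup>+ x. ennreal (normal_density 0 \<sigma> x) \<partial>lborel) = 1"
    using assms by (subst nn_integral_eq_integral) auto
  moreover have "(\<integral>\<^sup>+ w. ennreal (\<Prod>k\<in>UNIV. normal_density 0 \<sigma> (w $ k)) \<partial>(lborel :: (real ^ 'n) measure)) =
      (\<integral>\<^sup>+ w. (\<Prod>b\<in>Basis. ennreal (normal_density 0 \<sigma> (w \<bullet> b))) \<partial>(lborel :: (real ^ 'n) measure))"
    by (simp add: prod_Basis_vec inner_axis prod_ennreal normal_density_nonneg)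
  ultimately show "(\<integral>\<^sup>+ w. ennreal (\<Prod>k\<in>UNIV. normal_density 0 \<sigma> (w $ k)) \<partial>(lborel :: (real ^ 'n) measure)) = ennreal 1"
    by (subst (asm) nn_integral_lborel_prod) (simp_all add: normal_density_nonneg)
qed (auto intro!: prod_nonneg normal_density_nonneg)

lemma integral_lborel_vec_affine:
  fixes s y :: "real ^ 'n" and f :: "real ^ 'n \<Rightarrow> real"
  assumes s: "\<And>k. s $ k > 0" and f: "f \<in> borel_measurable borel"
  shows "(\<integral>z. f z \<partial>lborel) = (\<integral>w. (\<Prod>k\<in>UNIV. s $ k) * f (\<chi> k. y $ k + s $ k * w $ k) \<partial>lborel)"
proof -
  let ?T = "\<lambda>w. y + (\<Sum>j\<in>Basis. ((s \<bullet> j) * (w \<bullet> j)) *\<^sub>R j)"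
  have T: "?T w = (\<chi> k. y $ k + s $ k * w $ k)" for w
  proof -
    have "(\<Sum>j\<in>Basis. ((s \<bullet> j) * (w \<bullet> j)) *\<^sub>R j) = (\<Sum>k\<in>UNIV. (s $ k * w $ k) *\<^sub>R axis k 1)"
      unfolding sum_Basis_vec by (simp add: inner_axis)
    also have "\<dots> = (\<chi> k. s $ k * w $ k)"
      by (simp add: Finite_Cartesian_Product.vec_eq_iff axis_def if_distrib[of "\<lambda>x. _ * x"] cong: if_cong)
    finally show ?thesis by (simp add: Finite_Cartesian_Product.vec_eq_iff)
  qed
  have [measurable]: "?T \<in> borel \<rightarrow>\<^sub>M borel" by simp
  have "s \<bullet> j \<noteq> 0" if "j \<in> Basis" for j
    using that s by (auto simp: Basis_vec_def inner_axis less_imp_neq[THEN not_sym])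
  from lborel_affine_euclidean[of "\<lambda>j. s \<bullet> j", OF this, of y]
  have "(\<integral>z. f z \<partial>lborel) = (\<integral>z. f z \<partial>density (distr lborel borel ?T) (\<lambda>_. ennreal (\<Prod>j\<in>Basis. \<bar>s \<bullet> j\<bar>)))"
    by simp
  also have "\<dots> = (\<integral>z. (\<Prod>j\<in>Basis. \<bar>s \<bullet> j\<bar>) *\<^sub>R f z \<partial>distr lborel borel ?T)"
    using f by (intro integral_density) (auto intro!: prod_nonneg)
  also have "\<dots> = (\<integral>w. (\<Prod>j\<in>Basis. \<bar>s \<bullet> j\<bar>) *\<^sub>R f (?T w) \<partial>lborel)"
    using f by (intro integral_distr) auto
  also have "(\<Prod>j\<in>Basis. \<bar>s \<bullet> j\<bar>) = (\<Prod>k\<in>UNIV. s $ k)"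
    using s by (simp add: prod_Basis_vec inner_axis less_imp_le)
  finally show ?thesis by (simp only: T real_scaleR_def)
qed

section \<open>Domination of the kernel by itself at a later time\<close>

text \<open>
  The factors that derivatives produce in front of the kernel. A parameter \<open>x\<close> is a pair of an elapsed
  time and a point. The bound is exponential rather than polynomial because it is then
  stable under sums and products without any bookkeeping of degrees, and the Gaussian absorbs it all
  the same.
\<close>

definition tempered :: "(real \<times> (real ^ 'n) \<Rightarrow> real ^ 'n \<Rightarrow> real) \<Rightarrow> bool" where
  "tempered P \<longleftrightarrow> continuous_on (({0<..} \<times> UNIV) \<times> UNIV) (\<lambda>(x, z). P x z) \<and>
     (\<forall>C. compact C \<and> C \<subseteq> {0<..} \<times> UNIV \<longrightarrow> (\<exists>c m. \<forall>x\<in>C. \<forall>z. \<bar>P x z\<bar> \<le> c * exp (m * norm z)))"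

lemma tempered_coeff:
  fixes a :: "real \<times> (real ^ 'n) \<Rightarrow> real"
  assumes "continuous_on ({0<..} \<times> UNIV) a"
  shows "tempered (\<lambda>x z. a x)"
  unfolding tempered_def
proof (intro conjI allI impI)
  have "continuous_on (({0<..} \<times> UNIV) \<times> UNIV) (\<lambda>xz. a (fst xz))"
    by (rule continuous_on_compose2[OF assms]) (auto intro!: continuous_intros)
  then show "continuous_on (({0<..} \<times> UNIV) \<times> UNIV) (\<lambda>(x, z). a x)"
    by (simp add: case_prod_unfold)
  fix C :: "(real \<times> (real ^ 'n)) set" assume C: "compact C \<and> C \<subseteq> {0<..} \<times> UNIV"
  then have "compact (a ` C)"
    using continuous_on_subset[OF assms] by (blast intro: compact_continuous_image)
  from compact_imp_bounded[OF this] obtain c where "\<And>x. x \<in> C \<Longrightarrow> \<bar>a x\<bar> \<le> c"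
    by (auto simp: bounded_iff)
  then show "\<exists>c m. \<forall>x\<in>C. \<forall>z. \<bar>a x\<bar> \<le> c * exp (m * norm z)"
    by (intro exI[of _ c] exI[of _ 0]) auto
qed

lemma tempered_coord: "tempered (\<lambda>x z. z $ k)"
  unfolding tempered_def
proof (intro conjI allI impI)
  show "continuous_on (({0<..} \<times> UNIV) \<times> UNIV) (\<lambda>(x, z). z $ k)"
    unfolding case_prod_unfold by (intro continuous_intros)
  have "\<bar>z $ k\<bar> \<le> 1 * exp (1 * norm z)" for z :: "real ^ 'a"
    using component_le_norm_cart[of z k] exp_ge_add_one_self[of "norm z"] unfolding mult_1 by linarith
  then show "\<exists>c m. \<forall>x\<in>C. \<forall>z :: real ^ 'a. \<bar>z $ k\<bar> \<le> c * exp (m * norm z)" for C :: "(real \<times> (real ^ 'a)) set"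
    by blast
qed

lemma tempered_add:
  fixes P Q :: "real \<times> (real ^ 'n) \<Rightarrow> real ^ 'n \<Rightarrow> real"
  assumes "tempered P" "tempered Q"
  shows "tempered (\<lambda>x z. P x z + Q x z)"
  unfolding tempered_def
proof (intro conjI allI impI)
  show "continuous_on (({0<..} \<times> UNIV) \<times> UNIV) (\<lambda>(x, z). P x z + Q x z)"
    using assms unfolding tempered_def case_prod_unfold by (auto intro!: continuous_on_add)
  fix C :: "(real \<times> (real ^ 'n)) set" assume C: "compact C \<and> C \<subseteq> {0<..} \<times> UNIV"
  obtain c m where 1: "\<And>x z. x \<in> C \<Longrightarrow> \<bar>P x z\<bar> \<le> c * exp (m * norm z)"
    using assms(1) C unfolding tempered_def by metis
  obtain c' m' where 2: "\<And>x z. x \<in> C \<Longrightarrow> \<bar>Q x z\<bar> \<le> c' * exp (m' * norm z)"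
    using assms(2) C unfolding tempered_def by metis
  have "\<bar>P x z + Q x z\<bar> \<le> (\<bar>c\<bar> + \<bar>c'\<bar>) * exp ((\<bar>m\<bar> + \<bar>m'\<bar>) * norm z)" if "x \<in> C" for x z
  proof -
    have e: "exp (m * norm z) \<le> exp ((\<bar>m\<bar> + \<bar>m'\<bar>) * norm z)" "exp (m' * norm z) \<le> exp ((\<bar>m\<bar> + \<bar>m'\<bar>) * norm z)"
      by (auto intro!: mult_right_mono)
    have "c * exp (m * norm z) \<le> \<bar>c\<bar> * exp ((\<bar>m\<bar> + \<bar>m'\<bar>) * norm z)"
      "c' * exp (m' * norm z) \<le> \<bar>c'\<bar> * exp ((\<bar>m\<bar> + \<bar>m'\<bar>) * norm z)"
      by (rule mult_mono[OF abs_ge_self e(1)] mult_mono[OF abs_ge_self e(2)]; simp)+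
    then show ?thesis using 1[OF that, of z] 2[OF that, of z] abs_triangle_ineq[of "P x z" "Q x z"]
      unfolding distrib_right[of "\<bar>c\<bar>" "\<bar>c'\<bar>"] by linarith
  qed
  then show "\<exists>c m. \<forall>x\<in>C. \<forall>z. \<bar>P x z + Q x z\<bar> \<le> c * exp (m * norm z)" by blast
qed

lemma tempered_mult:
  fixes P Q :: "real \<times> (real ^ 'n) \<Rightarrow> real ^ 'n \<Rightarrow> real"
  assumes "tempered P" "tempered Q"
  shows "tempered (\<lambda>x z. P x z * Q x z)"
  unfolding tempered_def
proof (intro conjI allI impI)
  show "continuous_on (({0<..} \<times> UNIV) \<times> UNIV) (\<lambda>(x, z). P x z * Q x z)"
    using assms unfolding tempered_def case_prod_unfold by (auto intro!: continuous_on_mult)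
  fix C :: "(real \<times> (real ^ 'n)) set" assume C: "compact C \<and> C \<subseteq> {0<..} \<times> UNIV"
  obtain c m where 1: "\<And>x z. x \<in> C \<Longrightarrow> \<bar>P x z\<bar> \<le> c * exp (m * norm z)"
    using assms(1) C unfolding tempered_def by metis
  obtain c' m' where 2: "\<And>x z. x \<in> C \<Longrightarrow> \<bar>Q x z\<bar> \<le> c' * exp (m' * norm z)"
    using assms(2) C unfolding tempered_def by metis
  have "\<bar>P x z * Q x z\<bar> \<le> (c * c') * exp ((m + m') * norm z)" if "x \<in> C" for x z
  proof -
    have "\<bar>P x z\<bar> * \<bar>Q x z\<bar> \<le> (c * exp (m * norm z)) * (c' * exp (m' * norm z))"
      using 1[OF that, of z] 2[OF that, of z] abs_ge_zero[of "P x z"] by (intro mult_mono) linarith+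
    also have "\<dots> = (c * c') * exp ((m + m') * norm z)" unfolding distrib_right exp_add by simp
    finally show ?thesis unfolding abs_mult .
  qed
  then show "\<exists>c m. \<forall>x\<in>C. \<forall>z. \<bar>P x z * Q x z\<bar> \<le> c * exp (m * norm z)" by blast
qed

lemma tempered_sum:
  assumes "finite I" "\<And>i. i \<in> I \<Longrightarrow> tempered (P i)"
  shows "tempered (\<lambda>x z. \<Sum>i\<in>I. P i x z)"
  using assms
proof (induction I rule: finite_induct)
  case empty
  then show ?case using tempered_coeff[of "\<lambda>_. 0"] by simp
next
  case (insert i I)
  then show ?case using tempered_add[of "P i" "\<lambda>x z. \<Sum>i\<in>I. P i x z"] by simp
qed

text \<open>
  Between the times \<open>\<tau>\<close> and \<open>\<tau>'\<close> the coefficient of \<open>- z\<^sup>2 / 2\<close> drops by at least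
  \<open>\<epsilon> = A(\<tau>2) - A(\<tau>') > 0\<close>. This leaves \<open>\<epsilon> z\<^sup>2 / 2\<close> to absorb the terms linear in \<open>z\<close>,
  at the cost of a constant and a multiple of \<open>y\<^sup>2\<close>.
\<close>

lemma log_mehler_dominated:
  assumes "d \<ge> 0" "0 < \<tau>1" "\<tau>2 < \<tau>'"
  obtains c a where "a \<ge> 0"
    "\<And>\<tau> y z. \<tau> \<in> {\<tau>1..\<tau>2} \<Longrightarrow>
       \<bar>m\<bar> * \<bar>z\<bar> + log_mehler d \<tau> y z \<le> c + a * y\<^sup>2 + log_mehler d \<tau>' 0 z"
proof (cases "\<tau>1 \<le> \<tau>2")
  case True
  define \<epsilon> where "\<epsilon> = mehler_A d \<tau>2 - mehler_A d \<tau>'"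
  define \<beta> where "\<beta> = mehler_B d \<tau>1"
  define c where "c = ln (\<beta> / (2 * pi)) / 2 - ln (mehler_B d \<tau>' / (2 * pi)) / 2 + m\<^sup>2 / \<epsilon>"
  have \<epsilon>: "\<epsilon> > 0" using mehler_A_strict_antimono[of d \<tau>2 \<tau>'] assms True by (simp add: \<epsilon>_def)
  have \<beta>: "\<beta> > 0" using mehler_B_pos assms by (simp add: \<beta>_def)
  have "\<bar>m\<bar> * \<bar>z\<bar> + log_mehler d \<tau> y z \<le> c + \<beta>\<^sup>2 / \<epsilon> * y\<^sup>2 + log_mehler d \<tau>' 0 z"
    if \<tau>: "\<tau> \<in> {\<tau>1..\<tau>2}" for \<tau> y z
  proof -
    have \<tau>0: "\<tau> > 0" using \<tau> assms by auto
    have B: "0 < mehler_B d \<tau>" "mehler_B d \<tau> \<le> \<beta>"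
      using mehler_B_pos[OF assms(1) \<tau>0] mehler_B_antimono[of d \<tau>1 \<tau>] \<tau> assms by (auto simp: \<beta>_def)
    have A: "mehler_A d \<tau>2 \<le> mehler_A d \<tau>"
      using mehler_A_strict_antimono[of d \<tau> \<tau>2] \<tau> \<tau>0 assms by (cases "\<tau> = \<tau>2") auto
    have "ln (mehler_B d \<tau> / (2 * pi)) \<le> ln (\<beta> / (2 * pi))"
      using B by (simp add: divide_right_mono)
    moreover have "mehler_B d \<tau> * y * z \<le> \<beta> * \<bar>y\<bar> * \<bar>z\<bar>"
    proof -
      have "mehler_B d \<tau> * y * z \<le> mehler_B d \<tau> * (\<bar>y\<bar> * \<bar>z\<bar>)"
        using B abs_ge_self[of "y * z"] by (simp add: abs_mult)
      also have "\<dots> \<le> \<beta> * (\<bar>y\<bar> * \<bar>z\<bar>)" using B by (intro mult_right_mono) auto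
      finally show ?thesis by simp
    qed
    moreover have "mehler_A d \<tau>2 * z\<^sup>2 \<le> mehler_A d \<tau> * (y\<^sup>2 + z\<^sup>2)"
      using A mehler_A_pos[OF assms(1) \<tau>0] by (intro mult_mono) auto
    moreover have "\<bar>m\<bar> * \<bar>z\<bar> + \<beta> * \<bar>y\<bar> * \<bar>z\<bar> \<le> \<epsilon> * z\<^sup>2 / 2 + m\<^sup>2 / \<epsilon> + \<beta>\<^sup>2 / \<epsilon> * y\<^sup>2"
    proof -
      \<comment> \<open>Young's inequality, used once for each of the two linear terms\<close>
      have sq: "p * \<bar>z\<bar> \<le> \<epsilon> * z\<^sup>2 / 4 + p\<^sup>2 / \<epsilon>" for p
      proof -
        have "0 \<le> (\<epsilon> * \<bar>z\<bar> / 2 - p)\<^sup>2 / \<epsilon>" using \<epsilon> by simp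
        also have "\<dots> = \<epsilon> * z\<^sup>2 / 4 + p\<^sup>2 / \<epsilon> - p * \<bar>z\<bar>"
          using \<epsilon> by (simp add: power2_diff field_simps) (simp add: power2_eq_square)
        finally show ?thesis by simp
      qed
      have "(\<beta> * \<bar>y\<bar>)\<^sup>2 / \<epsilon> = \<beta>\<^sup>2 / \<epsilon> * y\<^sup>2" by (simp add: power_mult_distrib)
      with sq[of "\<bar>m\<bar>"] sq[of "\<beta> * \<bar>y\<bar>"] show ?thesis by simp
    qed
    ultimately show ?thesis
      unfolding log_mehler_def c_def \<epsilon>_def by (simp add: left_diff_distrib diff_divide_distrib)
  qed
  then show ?thesis using that[of "\<beta>\<^sup>2 / \<epsilon>" c] \<epsilon> by simp
next
  case False
  then show ?thesis using that[of 0 0] by auto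
qed

text \<open>
  The bound is uniform in \<open>y\<close>. It provides majorants for parameters in compact sets, and it is also the
  growth estimate for times bounded away from \<open>0\<close>.
\<close>

lemma mehler_kernel_dominated:
  fixes d :: "real ^ 'n"
  assumes d: "\<And>k. d $ k \<ge> 0" and \<tau>: "0 < \<tau>1" "\<tau>2 < \<tau>'"
  obtains c a where "c \<ge> 0" "a \<ge> 0"
    "\<And>\<tau> y z. \<tau> \<in> {\<tau>1..\<tau>2} \<Longrightarrow>
       exp (m * norm z) * mehler_kernel d \<tau> y z \<le> c * exp (a * (norm y)\<^sup>2) * mehler_kernel d \<tau>' 0 z"
proof -
  have "\<forall>k. \<exists>c a. a \<ge> 0 \<and> (\<forall>\<tau>\<in>{\<tau>1..\<tau>2}. \<forall>y z.
      \<bar>m\<bar> * \<bar>z\<bar> + log_mehler (d $ k) \<tau> y z \<le> c + a * y\<^sup>2 + log_mehler (d $ k) \<tau>' 0 z)"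
    using log_mehler_dominated[OF d \<tau>] by metis
  then obtain c a where a: "\<And>k. a k \<ge> 0" and
    le: "\<And>k \<tau> y z. \<tau> \<in> {\<tau>1..\<tau>2} \<Longrightarrow>
      \<bar>m\<bar> * \<bar>z\<bar> + log_mehler (d $ k) \<tau> y z \<le> c k + a k * y\<^sup>2 + log_mehler (d $ k) \<tau>' 0 z"
    by metis
  have "exp (m * norm z) * mehler_kernel d \<tau> y z \<le>
      exp (\<Sum>k\<in>UNIV. c k) * exp ((\<Sum>k\<in>UNIV. a k) * (norm y)\<^sup>2) * mehler_kernel d \<tau>' 0 z"
    if "\<tau> \<in> {\<tau>1..\<tau>2}" for \<tau> and y z :: "real ^ 'n"
  proof -
    have "m * norm z \<le> \<bar>m\<bar> * (\<Sum>k\<in>UNIV. \<bar>z $ k\<bar>)"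
      using norm_le_l1_cart[of z] by (intro mult_mono) auto
    then have "m * norm z + (\<Sum>k\<in>UNIV. log_mehler (d $ k) \<tau> (y $ k) (z $ k))
      \<le> (\<Sum>k\<in>UNIV. \<bar>m\<bar> * \<bar>z $ k\<bar> + log_mehler (d $ k) \<tau> (y $ k) (z $ k))"
      by (simp add: sum.distrib sum_distrib_left)
    also have "\<dots> \<le> (\<Sum>k\<in>UNIV. c k + a k * (y $ k)\<^sup>2 + log_mehler (d $ k) \<tau>' 0 (z $ k))"
      by (intro sum_mono le that)
    also have "\<dots> \<le> (\<Sum>k\<in>UNIV. c k + a k * (norm y)\<^sup>2 + log_mehler (d $ k) \<tau>' 0 (z $ k))"
      using a component_le_norm_cart[of y]
      by (intro sum_mono add_mono mult_left_mono) (auto intro: power2_le_iff_abs_le[THEN iffD2])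
    finally show ?thesis
      unfolding mehler_kernel_def exp_add[symmetric]
      by (simp add: sum.distrib sum_distrib_right)
  qed
  then show ?thesis using that[of "exp (\<Sum>k\<in>UNIV. c k)" "\<Sum>k\<in>UNIV. a k"] a by (simp add: sum_nonneg)
qed

section \<open>Moments of the kernel and their derivatives\<close>

lemma continuous_on_section:
  assumes "continuous_on (X \<times> UNIV) (\<lambda>(x, z). F x z)"
  shows "continuous_on X (\<lambda>x. F x z)" and "x \<in> X \<Longrightarrow> continuous_on UNIV (F x)"
proof -
  have "continuous_on X ((\<lambda>(x, z). F x z) \<circ> (\<lambda>x. (x, z)))"
    by (intro continuous_on_compose continuous_intros continuous_on_subset[OF assms]) auto
  then show "continuous_on X (\<lambda>x. F x z)" by (simp add: comp_def)
  assume "x \<in> X"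
  then have "continuous_on UNIV ((\<lambda>(x, z). F x z) \<circ> (\<lambda>z. (x, z)))"
    by (intro continuous_on_compose continuous_intros continuous_on_subset[OF assms]) auto
  then show "continuous_on UNIV (F x)" by (simp add: comp_def)
qed

lemma continuous_on_mehler_kernel:
  fixes d :: "real ^ 'n"
  assumes "\<And>k. d $ k \<ge> 0"
  shows "continuous_on (({0<..} \<times> UNIV) \<times> UNIV) (\<lambda>(x, z). mehler_kernel d (fst x) (snd x) z)"
proof -
  have "mehler_B (d $ k) \<tau> \<noteq> 0" if "\<tau> > 0" for k \<tau>
    using mehler_B_pos[OF assms that, of k] by simp
  then show ?thesis
    unfolding mehler_kernel_def log_mehler_def case_prod_unfold
    by (intro continuous_intros assms) auto
qed

text \<open>
  Integrability at the origin \<open>y = 0\<close> at all times implies it at every point, as the kernel at a point is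
  dominated by the kernel at the origin at a later time (\<open>mehler_kernel_dominated\<close>).
\<close>

locale mehler_integrable =
  fixes d :: "real ^ 'n" and f :: "real ^ 'n \<Rightarrow> real"
  assumes d_nonneg: "d $ k \<ge> 0"
    and f_continuous: "continuous_on UNIV f"
    and integrable_origin: "\<tau> > 0 \<Longrightarrow> integrable lborel (\<lambda>z. mehler_kernel d \<tau> 0 z * f z)"
begin

abbreviation K :: "real \<times> (real ^ 'n) \<Rightarrow> real ^ 'n \<Rightarrow> real" where
  "K x z \<equiv> mehler_kernel d (fst x) (snd x) z"

definition moment :: "(real \<times> (real ^ 'n) \<Rightarrow> real ^ 'n \<Rightarrow> real) \<Rightarrow> real \<times> (real ^ 'n) \<Rightarrow> real" where
  "moment P x = (\<integral>z. P x z * K x z * f z \<partial>lborel)"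

lemma integrand_continuous_param:
  assumes "tempered P"
  shows "continuous_on ({0<..} \<times> UNIV) (\<lambda>x. P x z * K x z * f z)"
proof -
  have "continuous_on ({0<..} \<times> UNIV) (\<lambda>x. P x z)"
    using assms continuous_on_section(1)[of "{0<..} \<times> UNIV" P] unfolding tempered_def by metis
  then show ?thesis
    using continuous_on_section(1)[OF continuous_on_mehler_kernel[OF d_nonneg]]
    by (intro continuous_on_mult continuous_on_const) auto
qed

lemma integrand_measurable:
  assumes "tempered P" "fst x > 0"
  shows "(\<lambda>z. P x z * K x z * f z) \<in> borel_measurable lborel"
proof -
  have x: "x \<in> {0<..} \<times> UNIV" using assms(2) by (simp add: mem_Times_iff)
  have "continuous_on UNIV (P x)"
    using assms x continuous_on_section(2)[of "{0<..} \<times> UNIV" P] unfolding tempered_def by metis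
  then have "continuous_on UNIV (\<lambda>z. P x z * K x z * f z)"
    using continuous_on_section(2)[OF continuous_on_mehler_kernel[OF d_nonneg] x]
    by (intro continuous_on_mult f_continuous) auto
  then show ?thesis by (simp add: borel_measurable_continuous_onI)
qed

text \<open>
  With \<open>\<tau>2\<close> the largest time in \<open>C\<close>, the majorant is a multiple of the kernel at time
  \<open>\<tau>2 + 1\<close> against \<open>|f|\<close>.
\<close>

lemma integrand_dominated:
  assumes "tempered P" "compact C" "C \<subseteq> {0<..} \<times> UNIV"
  shows "\<exists>g. integrable lborel g \<and> (\<forall>x\<in>C. \<forall>z. \<bar>P x z * K x z * f z\<bar> \<le> g z)"
proof (cases "C = {}")
  case False
  have "compact (fst ` C)" "fst ` C \<noteq> {}" "compact (snd ` C)"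
    using assms(2) False by (auto intro!: compact_continuous_image continuous_intros)
  obtain \<tau>1 where \<tau>1: "\<tau>1 \<in> fst ` C" "\<And>\<tau>. \<tau> \<in> fst ` C \<Longrightarrow> \<tau>1 \<le> \<tau>"
    using compact_attains_inf[OF \<open>compact (fst ` C)\<close> \<open>fst ` C \<noteq> {}\<close>] by blast
  obtain \<tau>2 where \<tau>2: "\<And>\<tau>. \<tau> \<in> fst ` C \<Longrightarrow> \<tau> \<le> \<tau>2"
    using compact_attains_sup[OF \<open>compact (fst ` C)\<close> \<open>fst ` C \<noteq> {}\<close>] by blast
  obtain R where R: "\<And>y. y \<in> snd ` C \<Longrightarrow> norm y \<le> R"
    using compact_imp_bounded[OF \<open>compact (snd ` C)\<close>] by (auto simp: bounded_iff)
  have pos: "0 < \<tau>1" using \<tau>1(1) assms(3) by auto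
  then have pos2: "0 < \<tau>2 + 1" using \<tau>2[OF \<tau>1(1)] by linarith
  obtain c m where cm: "\<And>x z. x \<in> C \<Longrightarrow> \<bar>P x z\<bar> \<le> c * exp (m * norm z)"
    using assms unfolding tempered_def by metis
  obtain c' a where c': "c' \<ge> 0" "a \<ge> 0" and
    dom: "\<And>\<tau> y z. \<tau> \<in> {\<tau>1..\<tau>2} \<Longrightarrow>
       exp (m * norm z) * mehler_kernel d \<tau> y z \<le> c' * exp (a * (norm y)\<^sup>2) * mehler_kernel d (\<tau>2 + 1) 0 z"
    using mehler_kernel_dominated[OF d_nonneg pos, of \<tau>2 "\<tau>2 + 1" m] by auto
  define g where "g z = \<bar>c\<bar> * (c' * exp (a * R\<^sup>2)) * \<bar>mehler_kernel d (\<tau>2 + 1) 0 z * f z\<bar>" for z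
  have "integrable lborel g"
    unfolding g_def using integrable_origin[OF pos2] by (intro integrable_mult_right integrable_abs)
  moreover have "\<bar>P x z * K x z * f z\<bar> \<le> g z" if x: "x \<in> C" for x z
  proof -
    have Kpos: "mehler_kernel d s y z > 0" for s y z by (simp add: mehler_kernel_def)
    have "\<bar>P x z\<bar> * K x z \<le> c * exp (m * norm z) * K x z"
      using cm[OF x, of z] Kpos by (intro mult_right_mono) (auto simp: less_imp_le)
    also have "\<dots> \<le> \<bar>c\<bar> * (exp (m * norm z) * K x z)"
      using Kpos[of "fst x" "snd x" z] by (simp add: mult.assoc mult_right_mono)
    also have "\<dots> \<le> \<bar>c\<bar> * (c' * exp (a * (norm (snd x))\<^sup>2) * mehler_kernel d (\<tau>2 + 1) 0 z)"
      using x \<tau>1(2) \<tau>2 by (intro mult_left_mono dom) auto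
    also have "\<dots> \<le> \<bar>c\<bar> * (c' * exp (a * R\<^sup>2) * mehler_kernel d (\<tau>2 + 1) 0 z)"
      using x R[of "snd x"] c' Kpos
      by (intro mult_left_mono mult_right_mono) (auto intro!: mult_left_mono power_mono simp: less_imp_le)
    finally have "\<bar>P x z\<bar> * K x z * \<bar>f z\<bar> \<le> \<bar>c\<bar> * (c' * exp (a * R\<^sup>2) * mehler_kernel d (\<tau>2 + 1) 0 z) * \<bar>f z\<bar>"
      by (rule mult_right_mono) simp
    then show ?thesis
      using Kpos[of "fst x" "snd x" z] Kpos[of "\<tau>2 + 1" 0 z] by (simp add: g_def abs_mult mult_ac)
  qed
  ultimately show ?thesis by blast
next
  case True
  then show ?thesis by (intro exI[of _ "\<lambda>_. 0"]) simp
qed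

lemma open_positive_times: "open ({0<..} \<times> UNIV :: (real \<times> (real ^ 'n)) set)"
  by (rule open_Times[OF open_greaterThan open_UNIV])

lemma integrand_locally_dominated:
  assumes "tempered P" "fst x > 0"
  shows "\<exists>e>0. cball x e \<subseteq> {0<..} \<times> UNIV \<and>
    (\<exists>g. integrable lborel g \<and> (\<forall>x'\<in>cball x e. \<forall>z. \<bar>P x' z * K x' z * f z\<bar> \<le> g z))"
proof -
  have "x \<in> {0<..} \<times> UNIV" using assms(2) by (simp add: mem_Times_iff)
  then obtain e where e: "e > 0" and sub: "cball x e \<subseteq> {0<..} \<times> UNIV"
    using open_positive_times open_contains_cball by metis
  from integrand_dominated[OF assms(1) compact_cball sub] e sub show ?thesis by metis
qed

lemma integrand_integrable:
  assumes "tempered P" "fst x > 0"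
  shows "integrable lborel (\<lambda>z. P x z * K x z * f z)"
proof -
  obtain e g where "e > 0" and g: "integrable lborel g"
    and le: "\<forall>x'\<in>cball x e. \<forall>z. \<bar>P x' z * K x' z * f z\<bar> \<le> g z"
    using integrand_locally_dominated[OF assms] by blast
  then have "x \<in> cball x e" by simp
  show ?thesis
  proof (rule Bochner_Integration.integrable_bound[OF g integrand_measurable[OF assms] AE_I2])
    show "norm (P x z * K x z * f z) \<le> norm (g z)" for z
      using le[rule_format, OF \<open>x \<in> cball x e\<close>, of z] by simp
  qed
qed

lemma continuous_on_moment:
  assumes "tempered P"
  shows "continuous_on ({0<..} \<times> UNIV) (moment P)"
  unfolding moment_def
proof (rule continuous_on_integral_dominated)
  fix x :: "real \<times> (real ^ 'n)" assume "x \<in> {0<..} \<times> UNIV"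
  then have x: "fst x > 0" by auto
  show "(\<lambda>z. P x z * K x z * f z) \<in> borel_measurable lborel"
    by (rule integrand_measurable[OF assms x])
  show "\<exists>e>0. \<exists>g. integrable lborel g \<and>
      (\<forall>x'\<in>{0<..} \<times> UNIV \<inter> ball x e. \<forall>z\<in>space lborel. \<bar>P x' z * K x' z * f z\<bar> \<le> g z)"
  proof -
    obtain e g where "e > 0" "integrable lborel g"
      and le: "\<forall>x'\<in>cball x e. \<forall>z. \<bar>P x' z * K x' z * f z\<bar> \<le> g z"
      using integrand_locally_dominated[OF assms x] by blast
    moreover have "\<bar>P x' z * K x' z * f z\<bar> \<le> g z" if "x' \<in> ball x e" for x' z
      using le that by simp
    ultimately show ?thesis
      by (intro exI[of _ e] exI[of _ g] conjI ballI) auto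
  qed
qed (rule integrand_continuous_param[OF assms])

text \<open>
  One statement serves the time derivative (\<open>v = (1, 0)\<close>) and the spatial ones
  (\<open>v = (0, axis k 1)\<close>). The pointwise derivative is assumed at \<open>s = 0\<close> only, but for every
  \<open>x\<close>, which gives it along the whole line.
\<close>

lemma moment_has_directional_derivative:
  assumes P: "tempered P" and Q: "tempered Q" and x: "fst x > 0" and v: "norm v \<le> 1"
    and der: "\<And>x z. fst x > 0 \<Longrightarrow>
      ((\<lambda>s. P (x + s *\<^sub>R v) z * K (x + s *\<^sub>R v) z) has_real_derivative Q x z * K x z) (at 0)"
  shows "((\<lambda>s. moment P (x + s *\<^sub>R v)) has_real_derivative moment Q x) (at 0)"
proof -
  obtain e g where e: "e > 0" "cball x e \<subseteq> {0<..} \<times> UNIV" and g: "integrable lborel g"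
    and le: "\<forall>x'\<in>cball x e. \<forall>z. \<bar>Q x' z * K x' z * f z\<bar> \<le> g z"
    using integrand_locally_dominated[OF Q x] by blast
  have near: "x + s *\<^sub>R v \<in> cball x e" if "\<bar>s - 0\<bar> < e" for s
  proof -
    have "\<bar>s\<bar> * norm v \<le> e * 1" using that v by (intro mult_mono) auto
    then show ?thesis by (simp add: dist_norm)
  qed
  have near': "fst (x + s *\<^sub>R v) > 0" if "\<bar>s - 0\<bar> < e" for s
  proof -
    have "x + s *\<^sub>R v \<in> {0<..} \<times> UNIV" using near[OF that] e(2) by blast
    then show ?thesis by (simp only: mem_Times_iff greaterThan_iff)
  qed
  have "((\<lambda>s. \<integral>z. P (x + s *\<^sub>R v) z * K (x + s *\<^sub>R v) z * f z \<partial>lborel) has_real_derivative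
      (\<integral>z. Q (x + 0 *\<^sub>R v) z * K (x + 0 *\<^sub>R v) z * f z \<partial>lborel)) (at 0)"
  proof (rule has_real_derivative_integral[OF e(1) _ _ _ g])
    fix s :: real and z assume s: "\<bar>s - 0\<bar> < e"
    show "integrable lborel (\<lambda>z. P (x + s *\<^sub>R v) z * K (x + s *\<^sub>R v) z * f z)"
      by (rule integrand_integrable[OF P near'[OF s]])
    show "\<bar>Q (x + s *\<^sub>R v) z * K (x + s *\<^sub>R v) z * f z\<bar> \<le> g z"
      by (rule le[rule_format, OF near[OF s]])
    have shift: "(x + s *\<^sub>R v) + h *\<^sub>R v = x + (h + s) *\<^sub>R v" for h
      by (simp add: scaleR_add_left add_ac)
    from der[OF near'[OF s], of z]
    have "((\<lambda>h. P (x + (h + s) *\<^sub>R v) z * K (x + (h + s) *\<^sub>R v) z) has_real_derivative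
        Q (x + s *\<^sub>R v) z * K (x + s *\<^sub>R v) z) (at 0)"
      unfolding shift .
    then have "((\<lambda>s. P (x + s *\<^sub>R v) z * K (x + s *\<^sub>R v) z) has_real_derivative
        Q (x + s *\<^sub>R v) z * K (x + s *\<^sub>R v) z) (at s)"
      using DERIV_shift[of "\<lambda>s. P (x + s *\<^sub>R v) z * K (x + s *\<^sub>R v) z" _ 0 s] by simp
    then show "((\<lambda>s. P (x + s *\<^sub>R v) z * K (x + s *\<^sub>R v) z * f z) has_real_derivative
        Q (x + s *\<^sub>R v) z * K (x + s *\<^sub>R v) z * f z) (at s)"
      by (rule DERIV_cmult_right)
  next
    show "(\<lambda>z. Q (x + 0 *\<^sub>R v) z * K (x + 0 *\<^sub>R v) z * f z) \<in> borel_measurable lborel"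
      using integrand_measurable[OF Q x] by simp
  qed
  then show ?thesis by (simp add: moment_def)
qed

text \<open>
  The factors that multiply the kernel after differentiation: \<open>slope k\<close> is the logarithmic derivative
  in the direction \<open>k\<close>, \<open>curvature k l\<close> belongs to the second derivative in the directions
  \<open>k\<close> and \<open>l\<close>, and \<open>rate\<close> to the time derivative. That the last one is the trace of the second
  minus the potential is the differential equation for the kernel.
\<close>

definition slope :: "'n \<Rightarrow> real \<times> (real ^ 'n) \<Rightarrow> real ^ 'n \<Rightarrow> real" where
  "slope k x z = mehler_B (d $ k) (fst x) * z $ k - mehler_A (d $ k) (fst x) * snd x $ k"

definition curvature :: "'n \<Rightarrow> 'n \<Rightarrow> real \<times> (real ^ 'n) \<Rightarrow> real ^ 'n \<Rightarrow> real" where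
  "curvature k l x z = slope l x z * slope k x z - (if k = l then mehler_A (d $ k) (fst x) else 0)"

definition rate :: "real \<times> (real ^ 'n) \<Rightarrow> real ^ 'n \<Rightarrow> real" where
  "rate x z = (\<Sum>k\<in>UNIV. curvature k k x z) - (\<Sum>k\<in>UNIV. d $ k * (snd x $ k)\<^sup>2)"

lemma tempered_slope: "tempered (slope k)"
proof -
  have "tempered (\<lambda>x z. mehler_B (d $ k) (fst x) * z $ k + - (mehler_A (d $ k) (fst x) * snd x $ k))"
    using d_nonneg
    by (intro tempered_add[OF tempered_mult[OF tempered_coeff tempered_coord] tempered_coeff])
       (auto intro!: continuous_intros)
  then show ?thesis by (simp add: slope_def[abs_def])
qed

lemma tempered_curvature: "tempered (curvature k l)"
proof -
  have "tempered (\<lambda>x z. slope l x z * slope k x z + - (if k = l then mehler_A (d $ k) (fst x) else 0))"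
    using d_nonneg
    by (intro tempered_add[OF tempered_mult[OF tempered_slope tempered_slope] tempered_coeff])
       (cases "k = l"; auto intro!: continuous_intros)
  then show ?thesis by (simp add: curvature_def[abs_def])
qed

lemma tempered_rate: "tempered rate"
proof -
  have "tempered (\<lambda>x z. (\<Sum>k\<in>UNIV. curvature k k x z) + - (\<Sum>k\<in>UNIV. d $ k * (snd x $ k)\<^sup>2))"
    by (intro tempered_add[OF tempered_sum[OF _ tempered_curvature] tempered_coeff])
       (auto intro!: continuous_intros)
  then show ?thesis by (simp add: rate_def[abs_def])
qed

lemma mehler_kernel_derivative_space:
  "((\<lambda>s. K (x + s *\<^sub>R (0, axis k 1)) z) has_real_derivative slope k x z * K x z) (at 0)"
proof -
  have "((\<lambda>s. log_mehler (d $ j) (fst x) (snd x $ j + s * axis k 1 $ j) (z $ j)) has_real_derivative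
      (if j = k then slope k x z else 0)) (at 0)" for j
    unfolding log_mehler_def
    by (auto intro!: derivative_eq_intros simp: axis_def slope_def)
  then have "((\<lambda>s. \<Sum>j\<in>UNIV. log_mehler (d $ j) (fst x) (snd x $ j + s * axis k 1 $ j) (z $ j)) has_real_derivative
      (\<Sum>j\<in>UNIV. if j = k then slope k x z else 0)) (at 0)"
    by (intro DERIV_sum)
  from DERIV_chain2[OF DERIV_exp this]
  have "((\<lambda>s. mehler_kernel d (fst x) (snd x + s *\<^sub>R axis k 1) z) has_real_derivative K x z * slope k x z) (at 0)"
    unfolding mehler_kernel_def vector_add_component vector_scaleR_component mult_zero_left add_0_right
    by (simp add: sum.delta)
  then show ?thesis by (simp add: mult.commute)
qed

lemma slope_derivative_space:
  "((\<lambda>s. slope k (x + s *\<^sub>R (0, axis l 1)) z) has_real_derivative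
      - (if k = l then mehler_A (d $ k) (fst x) else 0)) (at 0)"
proof -
  have eq: "slope k (x + s *\<^sub>R (0, axis l 1)) z =
      mehler_B (d $ k) (fst x) * z $ k - mehler_A (d $ k) (fst x) * (snd x $ k + s * axis l 1 $ k)" for s
    by (simp add: slope_def)
  have "((\<lambda>s. mehler_B (d $ k) (fst x) * z $ k - mehler_A (d $ k) (fst x) * (snd x $ k + s * axis l 1 $ k))
      has_real_derivative 0 - mehler_A (d $ k) (fst x) * (0 + 1 * axis l 1 $ k)) (at 0)"
    by (intro DERIV_diff DERIV_const DERIV_cmult DERIV_add DERIV_cmult_right DERIV_ident)
  then show ?thesis unfolding eq by (simp add: axis_def split: if_splits)
qed

lemma slope_kernel_derivative_space:
  "((\<lambda>s. slope k (x + s *\<^sub>R (0, axis l 1)) z * K (x + s *\<^sub>R (0, axis l 1)) z) has_real_derivative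
      curvature k l x z * K x z) (at 0)"
proof -
  have "((\<lambda>s. slope k (x + s *\<^sub>R (0, axis l 1)) z * K (x + s *\<^sub>R (0, axis l 1)) z) has_real_derivative
      - (if k = l then mehler_A (d $ k) (fst x) else 0) * K x z + slope l x z * K x z * slope k x z) (at 0)"
    using DERIV_mult[OF slope_derivative_space[of k x l z] mehler_kernel_derivative_space[of x l z]]
    unfolding scaleR_zero_left add_0_right .
  also have "- (if k = l then mehler_A (d $ k) (fst x) else 0) * K x z + slope l x z * K x z * slope k x z
      = curvature k l x z * K x z"
    by (cases "k = l") (simp_all add: curvature_def left_diff_distrib)
  finally show ?thesis .
qed

text \<open>
  The one-dimensional equation in logarithmic form. Differentiating gives
  \<open>- A - 2 A B y z + B\<^sup>2 (y\<^sup>2 + z\<^sup>2)\<close>; the square on the right contains \<open>A\<^sup>2 y\<^sup>2\<close> instead of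
  \<open>B\<^sup>2 y\<^sup>2\<close>, and \<open>A\<^sup>2 - B\<^sup>2 = d\<close> turns the difference into the potential.
\<close>

lemma log_mehler_derivative_time:
  assumes "e \<ge> 0" "\<tau> > 0"
  shows "((\<lambda>\<tau>. log_mehler e \<tau> y z) has_real_derivative
    (mehler_B e \<tau> * z - mehler_A e \<tau> * y)\<^sup>2 - mehler_A e \<tau> - e * y\<^sup>2) (at \<tau>)"
proof -
  define A B where "A = mehler_A e \<tau>" and "B = mehler_B e \<tau>"
  have B: "B > 0" using mehler_B_pos[OF assms] by (simp add: B_def)
  have dA: "(mehler_A e has_real_derivative - 2 * B\<^sup>2) (at \<tau>)"
    and dB: "(mehler_B e has_real_derivative - 2 * A * B) (at \<tau>)"
    using mehler_A_has_real_derivative[OF assms] mehler_B_has_real_derivative[OF assms]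
    by (simp_all add: A_def B_def)
  have "((\<lambda>\<tau>. ln (mehler_B e \<tau> / (2 * pi))) has_real_derivative
      (- 2 * A * B) / (2 * pi) / (B / (2 * pi))) (at \<tau>)"
    using B by (auto intro!: derivative_eq_intros dB simp: B_def)
  also have "(- 2 * A * B) / (2 * pi) / (B / (2 * pi)) = - 2 * A" using B by simp
  finally have D: "((\<lambda>\<tau>. log_mehler e \<tau> y z) has_real_derivative
      - 2 * A / 2 + - 2 * A * B * y * z - - 2 * B\<^sup>2 * (y\<^sup>2 + z\<^sup>2) / 2) (at \<tau>)"
    unfolding log_mehler_def
    by (intro DERIV_diff DERIV_add DERIV_cdivide DERIV_cmult_right dA dB)
  have E: "- 2 * A / 2 + - 2 * A * B * y * z - - 2 * B\<^sup>2 * (y\<^sup>2 + z\<^sup>2) / 2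
      = (B * z - A * y)\<^sup>2 - A - e * y\<^sup>2"
  proof -
    have e: "e = A\<^sup>2 - B\<^sup>2" using mehler_A_square[OF assms] by (simp add: A_def B_def)
    show ?thesis unfolding e by (simp add: power2_eq_square field_simps)
  qed
  show ?thesis using DERIV_cong[OF D E] unfolding A_def B_def .
qed

lemma mehler_kernel_derivative_time:
  assumes "fst x > 0"
  shows "((\<lambda>s. K (x + s *\<^sub>R (1, 0)) z) has_real_derivative rate x z * K x z) (at 0)"
proof -
  have "((\<lambda>\<tau>. \<Sum>k\<in>UNIV. log_mehler (d $ k) \<tau> (snd x $ k) (z $ k)) has_real_derivative
     (\<Sum>k\<in>UNIV. (mehler_B (d $ k) (fst x) * z $ k - mehler_A (d $ k) (fst x) * snd x $ k)\<^sup>2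
        - mehler_A (d $ k) (fst x) - d $ k * (snd x $ k)\<^sup>2)) (at (fst x))"
    by (intro DERIV_sum log_mehler_derivative_time d_nonneg assms)
  also have "(\<Sum>k\<in>UNIV. (mehler_B (d $ k) (fst x) * z $ k - mehler_A (d $ k) (fst x) * snd x $ k)\<^sup>2
        - mehler_A (d $ k) (fst x) - d $ k * (snd x $ k)\<^sup>2) = rate x z"
    by (simp add: rate_def curvature_def slope_def sum_subtractf power2_eq_square)
  finally have "((\<lambda>s. \<Sum>k\<in>UNIV. log_mehler (d $ k) (fst x + s) (snd x $ k) (z $ k)) has_real_derivative rate x z) (at 0)"
    using DERIV_shift[of "\<lambda>\<tau>. \<Sum>k\<in>UNIV. log_mehler (d $ k) \<tau> (snd x $ k) (z $ k)" _ 0 "fst x"]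
    by (simp add: add.commute)
  from DERIV_chain2[OF DERIV_exp this]
  have "((\<lambda>s. mehler_kernel d (fst x + s) (snd x) z) has_real_derivative K x z * rate x z) (at 0)"
    unfolding mehler_kernel_def add_0_right .
  then show ?thesis by (simp add: mult.commute)
qed

end

section \<open>Behaviour at the initial time\<close>

lemma continuous_on_mehler_variance:
  assumes "d \<ge> 0"
  shows "continuous_on {0..} (\<lambda>\<tau>. 1 / mehler_B d \<tau>)"
proof -
  have "continuous_on {0..} (\<lambda>\<tau>. if d = 0 then 2 * \<tau> else sinh (2 * \<tau> * sqrt d) / sqrt d)"
  proof (cases "d = 0")
    case True
    have "continuous_on {0..} (\<lambda>\<tau> :: real. 2 * \<tau>)" by (intro continuous_intros)
    then show ?thesis using True by simp
  next
    case False
    then have "continuous_on {0..} (\<lambda>\<tau>. sinh (2 * \<tau> * sqrt d) / sqrt d)"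
      by (intro continuous_intros) simp
    then show ?thesis using False by simp
  qed
  then show ?thesis
    by (rule continuous_on_eq) (simp add: mehler_variance_eq[OF assms])
qed

lemma continuous_on_mehler_damping:
  assumes "d \<ge> 0"
  shows "continuous_on {0..} (\<lambda>\<tau>. mehler_A d \<tau> - mehler_B d \<tau>)"
proof -
  have "continuous_on {0..} (\<lambda>\<tau>. sqrt d * tanh (\<tau> * sqrt d))"
    by (intro continuous_intros) simp
  then show ?thesis
    by (rule continuous_on_eq) (simp add: mehler_damping_eq[OF assms])
qed

lemma inner_diagonal: "inner y (diagonal d *v y) = (\<Sum>k\<in>UNIV. d $ k * (y $ k)\<^sup>2)"
proof -
  have "(diagonal d *v y) $ k = d $ k * y $ k" for k
    by (simp add: matrix_vector_mult_def diagonal_def if_distrib[of "\<lambda>x. x * _"] cong: if_cong)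
  then show ?thesis by (simp add: inner_vec_def power2_eq_square mult_ac)
qed

locale mehler_cauchy = mehler_integrable d f for d :: "real ^ 'n" and f +
  assumes growth_ex: "\<exists>C a. \<forall>y. \<bar>f y\<bar> \<le> C * exp (a * (norm y)\<^sup>2)"
begin

text \<open>
  The substitution \<open>z = y + w / \<surd>B\<close> and the integrand that it produces: damping factor, initial value and
  standard normal density. By the default values at \<open>\<tau> = 0\<close> the point is then \<open>y\<close> and the damping
  factor \<open>1\<close>, which is what makes the formula continuous up to the initial time.
\<close>

definition rescaled_point :: "real \<times> (real ^ 'n) \<Rightarrow> real ^ 'n \<Rightarrow> real ^ 'n" where
  "rescaled_point x w = (\<chi> k. snd x $ k + sqrt (1 / mehler_B (d $ k) (fst x)) * w $ k)"

definition rescaled_integrand :: "real \<times> (real ^ 'n) \<Rightarrow> real ^ 'n \<Rightarrow> real" where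
  "rescaled_integrand x w = exp (- (\<Sum>k\<in>UNIV. (mehler_A (d $ k) (fst x) - mehler_B (d $ k) (fst x)) *
       ((snd x $ k)\<^sup>2 + (rescaled_point x w $ k)\<^sup>2) / 2)) *
     f (rescaled_point x w) * (\<Prod>k\<in>UNIV. std_normal_density (w $ k))"

text \<open>
  Completing the square: \<open>B y z - A (y\<^sup>2 + z\<^sup>2) / 2 = - (A - B) (y\<^sup>2 + z\<^sup>2) / 2 - B (z - y)\<^sup>2 / 2\<close>, and
  \<open>B (z - y)\<^sup>2 = w\<^sup>2\<close>. The factor \<open>\<surd>(1 / B)\<close> on the left is the Jacobian of the substitution.
\<close>

lemma log_mehler_rescale:
  assumes "e \<ge> 0" "\<tau> > 0"
  shows "sqrt (1 / mehler_B e \<tau>) * exp (log_mehler e \<tau> y (y + sqrt (1 / mehler_B e \<tau>) * w)) =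
    exp (- ((mehler_A e \<tau> - mehler_B e \<tau>) * (y\<^sup>2 + (y + sqrt (1 / mehler_B e \<tau>) * w)\<^sup>2) / 2)) *
    std_normal_density w"
proof -
  define A B \<sigma> where "A = mehler_A e \<tau>" and "B = mehler_B e \<tau>" and "\<sigma> = sqrt (1 / B)"
  define z where "z = y + \<sigma> * w"
  have B: "B > 0" using mehler_B_pos[OF assms] by (simp add: B_def)
  have B\<sigma>: "B * \<sigma>\<^sup>2 = 1" using B by (simp add: \<sigma>_def)
  have "B * (z - y)\<^sup>2 = B * \<sigma>\<^sup>2 * w\<^sup>2" by (simp add: z_def power_mult_distrib)
  then have "B * (z - y)\<^sup>2 = w\<^sup>2" using B\<sigma> by simp
  then have e1: "B * y * z - A * (y\<^sup>2 + z\<^sup>2) / 2 = - ((A - B) * (y\<^sup>2 + z\<^sup>2) / 2) + - w\<^sup>2 / 2"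
    by (simp add: power2_eq_square field_simps)
  have e2: "exp (ln (B / (2 * pi)) / 2) = sqrt (B / (2 * pi))"
  proof -
    have "exp (ln (B / (2 * pi)) / 2) ^ 2 = exp (ln (B / (2 * pi)))" by (simp flip: exp_double)
    also have "\<dots> = B / (2 * pi)" using B by simp
    finally show ?thesis by (metis exp_ge_zero real_sqrt_unique)
  qed
  have e3: "\<sigma> * sqrt (B / (2 * pi)) = 1 / sqrt (2 * pi)"
    using B by (simp add: \<sigma>_def real_sqrt_divide)
  have "log_mehler e \<tau> y z = ln (B / (2 * pi)) / 2 + (B * y * z - A * (y\<^sup>2 + z\<^sup>2) / 2)"
    by (simp add: log_mehler_def A_def B_def)
  then have "\<sigma> * exp (log_mehler e \<tau> y z) = (\<sigma> * sqrt (B / (2 * pi))) *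
      (exp (- ((A - B) * (y\<^sup>2 + z\<^sup>2) / 2)) * exp (- w\<^sup>2 / 2))"
    unfolding e1 exp_add e2 by (simp only: exp_add e2 mult.assoc)
  then have "\<sigma> * exp (log_mehler e \<tau> y z)
      = exp (- ((A - B) * (y\<^sup>2 + z\<^sup>2) / 2)) * (1 / sqrt (2 * pi) * exp (- w\<^sup>2 / 2))"
    unfolding e3 by (simp only: mult.left_commute)
  then show ?thesis
    unfolding std_normal_density_def z_def \<sigma>_def A_def B_def .
qed

lemma integral_kernel_eq_rescaled:
  assumes "fst x > 0"
  shows "(\<integral>z. K x z * f z \<partial>lborel) = (\<integral>w. rescaled_integrand x w \<partial>lborel)"
proof -
  let ?\<sigma> = "\<chi> k. sqrt (1 / mehler_B (d $ k) (fst x))"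
  have meas: "(\<lambda>z. K x z * f z) \<in> borel_measurable borel"
    using integrand_measurable[OF tempered_coeff[of "\<lambda>_. 1"] assms] by simp
  have "(\<integral>z. K x z * f z \<partial>lborel) =
      (\<integral>w. (\<Prod>k\<in>UNIV. ?\<sigma> $ k) * (K x (\<chi> k. snd x $ k + ?\<sigma> $ k * w $ k) *
        f (\<chi> k. snd x $ k + ?\<sigma> $ k * w $ k)) \<partial>lborel)"
    by (rule integral_lborel_vec_affine[OF _ meas]) (simp add: mehler_B_pos[OF d_nonneg assms])
  also have "\<dots> = (\<integral>w. rescaled_integrand x w \<partial>lborel)"
  proof (rule Bochner_Integration.integral_cong[OF refl])
    fix w
    have sp: "(\<chi> k. snd x $ k + ?\<sigma> $ k * w $ k) = rescaled_point x w" by (simp add: rescaled_point_def)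
    have "(\<Prod>k\<in>UNIV. ?\<sigma> $ k) * K x (rescaled_point x w) =
        (\<Prod>k\<in>UNIV. ?\<sigma> $ k * exp (log_mehler (d $ k) (fst x) (snd x $ k) (rescaled_point x w $ k)))"
      by (simp add: mehler_kernel_def exp_sum prod.distrib)
    also have "\<dots> = (\<Prod>k\<in>UNIV. exp (- ((mehler_A (d $ k) (fst x) - mehler_B (d $ k) (fst x)) *
       ((snd x $ k)\<^sup>2 + (rescaled_point x w $ k)\<^sup>2) / 2)) * std_normal_density (w $ k))"
    proof (intro prod.cong refl)
      fix k
      have "rescaled_point x w $ k = snd x $ k + sqrt (1 / mehler_B (d $ k) (fst x)) * w $ k"
        and "?\<sigma> $ k = sqrt (1 / mehler_B (d $ k) (fst x))" by (simp_all add: rescaled_point_def)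
      then show "?\<sigma> $ k * exp (log_mehler (d $ k) (fst x) (snd x $ k) (rescaled_point x w $ k)) =
        exp (- ((mehler_A (d $ k) (fst x) - mehler_B (d $ k) (fst x)) *
          ((snd x $ k)\<^sup>2 + (rescaled_point x w $ k)\<^sup>2) / 2)) * std_normal_density (w $ k)"
        using log_mehler_rescale[OF d_nonneg[of k] assms, of "snd x $ k" "w $ k"] by metis
    qed
    also have "\<dots> = exp (- (\<Sum>k\<in>UNIV. (mehler_A (d $ k) (fst x) - mehler_B (d $ k) (fst x)) *
       ((snd x $ k)\<^sup>2 + (rescaled_point x w $ k)\<^sup>2) / 2)) * (\<Prod>k\<in>UNIV. std_normal_density (w $ k))"
      unfolding prod.distrib sum_negf[symmetric] by (subst exp_sum) simp_all
    finally have eq: "(\<Prod>k\<in>UNIV. ?\<sigma> $ k) * K x (rescaled_point x w) = \<dots>" .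
    show "(\<Prod>k\<in>UNIV. ?\<sigma> $ k) * (K x (\<chi> k. snd x $ k + ?\<sigma> $ k * w $ k) *
        f (\<chi> k. snd x $ k + ?\<sigma> $ k * w $ k)) = rescaled_integrand x w"
      unfolding sp mult.assoc[symmetric] eq unfolding rescaled_integrand_def by simp
  qed
  finally show ?thesis .
qed

lemma rescaled_integrand_initial: "rescaled_integrand (0, y) w = f y * (\<Prod>k\<in>UNIV. std_normal_density (w $ k))"
proof -
  have "mehler_B e 0 = 0" "mehler_A e 0 = 0" for e
    by (simp_all add: mehler_A_def mehler_B_def coth_def csch_def)
  then show ?thesis by (simp add: rescaled_integrand_def rescaled_point_def)
qed

lemma continuous_on_rescaled_point: "continuous_on ({0..} \<times> UNIV) (\<lambda>x. rescaled_point x w)"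
  unfolding rescaled_point_def
proof (rule continuous_on_vec_lambda)
  fix k
  have "continuous_on ({0..} \<times> (UNIV :: (real ^ 'n) set)) (\<lambda>x. 1 / mehler_B (d $ k) (fst x))"
    by (rule continuous_on_compose2[OF continuous_on_mehler_variance[OF d_nonneg] continuous_on_fst[OF continuous_on_id]])
       (simp add: image_subset_iff)
  from continuous_on_mult_right[OF continuous_on_real_sqrt[OF this]]
  show "continuous_on ({0..} \<times> UNIV) (\<lambda>x. snd x $ k + sqrt (1 / mehler_B (d $ k) (fst x)) * w $ k)"
    by (rule continuous_on_add[OF continuous_on_component[OF continuous_on_snd[OF continuous_on_id]]])
qed

lemma continuous_on_rescaled_integrand: "continuous_on ({0..} \<times> UNIV) (\<lambda>x. rescaled_integrand x w)"
proof -
  have damp: "continuous_on ({0..} \<times> UNIV) (\<lambda>x. mehler_A (d $ k) (fst x) - mehler_B (d $ k) (fst x))" for k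
    by (rule continuous_on_compose2[OF continuous_on_mehler_damping[OF d_nonneg] continuous_on_fst[OF continuous_on_id]])
       (simp add: image_subset_iff)
  have fs: "continuous_on ({0..} \<times> UNIV) (\<lambda>x. f (rescaled_point x w))"
    by (rule continuous_on_compose2[OF f_continuous continuous_on_rescaled_point]) simp
  show ?thesis
    unfolding rescaled_integrand_def
    by (intro damp fs continuous_on_mult continuous_on_exp continuous_on_minus continuous_on_sum continuous_on_divide
        continuous_on_add continuous_on_power continuous_on_component continuous_on_rescaled_point
        continuous_on_snd continuous_on_id continuous_on_const) simp
qed

lemma rescaled_integrand_measurable: "rescaled_integrand x \<in> borel_measurable lborel"
proof -
  have sp: "continuous_on UNIV (\<lambda>w. rescaled_point x w)"
    unfolding rescaled_point_def
    by (rule continuous_on_vec_lambda)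
       (rule continuous_on_add[OF continuous_on_const
          continuous_on_mult_left[OF continuous_on_component[OF continuous_on_id]]])
  have fs: "continuous_on UNIV (\<lambda>w. f (rescaled_point x w))"
    by (rule continuous_on_compose2[OF f_continuous sp]) simp
  have "continuous_on UNIV (rescaled_integrand x)"
    unfolding rescaled_integrand_def[abs_def] std_normal_density_def
    by (intro sp fs continuous_on_mult continuous_on_exp continuous_on_minus continuous_on_sum continuous_on_divide
        continuous_on_add continuous_on_power continuous_on_component continuous_on_prod
        continuous_on_id continuous_on_const) simp_all
  then show ?thesis by (simp add: borel_measurable_continuous_onI)
qed

text \<open>
  The product of the functions \<open>exp (- w\<^sup>2 / 4) / \<surd>(2 \<pi>)\<close>, that is, the standard normal density multiplied
  by \<open>exp (|w|\<^sup>2 / 4)\<close>.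
\<close>

definition wide_gaussian :: "real ^ 'n \<Rightarrow> real" where
  "wide_gaussian w = (\<Prod>k\<in>UNIV. sqrt 2 * normal_density 0 (sqrt 2) (w $ k))"

lemma integrable_wide_gaussian: "integrable lborel wide_gaussian"
proof -
  have "integrable lborel (\<lambda>w :: real ^ 'n. \<Prod>k\<in>UNIV. normal_density 0 (sqrt 2) (w $ k))"
    using has_bochner_integral_prod_normal_density[of "sqrt 2"] by (auto simp: has_bochner_integral_iff)
  then show ?thesis
    unfolding wide_gaussian_def[abs_def] prod.distrib by (rule integrable_mult_right)
qed

text \<open>
  The initial value at \<open>y + w / \<surd>B\<close> is at most \<open>exp (2 a |y|\<^sup>2 + 2 a |w|\<^sup>2 / B)\<close> up to a constant. As \<open>1 / B\<close>
  tends to \<open>0\<close>, for small times the second term is at most \<open>|w|\<^sup>2 / 4\<close>, which half of the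
  Gaussian's exponent absorbs. Initial values of Gaussian growth can be treated in this way for short times only.
\<close>

lemma rescaled_integrand_dominated:
  obtains C a \<delta> where "C \<ge> 0" "a \<ge> 0" "\<delta> > 0"
    "\<And>x w. fst x \<in> {0..\<delta>} \<Longrightarrow> \<bar>rescaled_integrand x w\<bar> \<le> C * exp (a * (norm (snd x))\<^sup>2) * wide_gaussian w"
proof -
  obtain C0 a0 where f0: "\<And>y. \<bar>f y\<bar> \<le> C0 * exp (a0 * (norm y)\<^sup>2)" using growth_ex by blast
  define C a where "C = \<bar>C0\<bar>" and "a = \<bar>a0\<bar>"
  have f: "\<bar>f y\<bar> \<le> C * exp (a * (norm y)\<^sup>2)" for y
    by (rule order_trans[OF f0 mult_mono]) (auto simp: C_def a_def intro: mult_right_mono)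
  have "\<forall>\<^sub>F \<tau> in at_right 0. \<forall>k. 2 * a * (1 / mehler_B (d $ k) \<tau>) < 1 / 4"
  proof (rule eventually_all_finite)
    fix k
    have "((\<lambda>\<tau>. 1 / mehler_B (d $ k) \<tau>) \<longlongrightarrow> 1 / mehler_B (d $ k) 0) (at 0 within {0..})"
      using continuous_on_mehler_variance[OF d_nonneg] by (simp add: continuous_on)
    then have "((\<lambda>\<tau>. 1 / mehler_B (d $ k) \<tau>) \<longlongrightarrow> 0) (at_right 0)"
      by (rule tendsto_eq_rhs[OF tendsto_within_subset]) (auto simp: mehler_B_def csch_def)
    then have "((\<lambda>\<tau>. 2 * a * (1 / mehler_B (d $ k) \<tau>)) \<longlongrightarrow> 2 * a * 0) (at_right 0)"
      by (intro tendsto_mult_left)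
    then show "\<forall>\<^sub>F \<tau> in at_right 0. 2 * a * (1 / mehler_B (d $ k) \<tau>) < 1 / 4"
      by (rule order_tendstoD) simp
  qed
  then obtain \<delta>' where \<delta>': "\<delta>' > 0"
    "\<And>\<tau> k. 0 < \<tau> \<Longrightarrow> \<tau> < \<delta>' \<Longrightarrow> 2 * a * (1 / mehler_B (d $ k) \<tau>) < 1 / 4"
    unfolding eventually_at_right_field by blast
  define \<delta> where "\<delta> = \<delta>' / 2"
  have \<delta>: "\<delta> > 0" using \<delta>' by (simp add: \<delta>_def)
  have var: "2 * a * (1 / mehler_B (d $ k) \<tau>) \<le> 1 / 4" if "\<tau> \<in> {0..\<delta>}" for \<tau> k
  proof (cases "\<tau> = 0")
    case True
    then show ?thesis by (simp add: mehler_B_def csch_def)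
  next
    case False
    then show ?thesis using \<delta>'(2)[of \<tau> k] that \<delta> by (simp add: \<delta>_def)
  qed
  have "\<bar>rescaled_integrand x w\<bar> \<le> C * exp (2 * a * (norm (snd x))\<^sup>2) * wide_gaussian w"
    if x: "fst x \<in> {0..\<delta>}" for x w
  proof -
    have \<tau>: "fst x \<ge> 0" using x by simp
    have damp: "mehler_A (d $ k) (fst x) - mehler_B (d $ k) (fst x) \<ge> 0" for k
      unfolding mehler_damping_eq[OF d_nonneg \<tau>] using d_nonneg \<tau> by simp
    have "a * (rescaled_point x w $ k)\<^sup>2 \<le> 2 * a * (snd x $ k)\<^sup>2 + (w $ k)\<^sup>2 / 4" for k
    proof -
      define \<sigma> where "\<sigma> = sqrt (1 / mehler_B (d $ k) (fst x))"
      have "0 \<le> 1 / mehler_B (d $ k) (fst x)"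
        unfolding mehler_variance_eq[OF d_nonneg \<tau>] using \<tau> d_nonneg by simp
      then have \<sigma>: "2 * a * \<sigma>\<^sup>2 \<le> 1 / 4" using var[OF x, of k] by (simp add: \<sigma>_def)
      have "(snd x $ k + \<sigma> * w $ k)\<^sup>2 \<le> 2 * (snd x $ k)\<^sup>2 + 2 * (\<sigma> * w $ k)\<^sup>2"
        using sum_squares_bound[of "snd x $ k" "\<sigma> * w $ k"] by (simp add: power2_sum)
      then have "a * (snd x $ k + \<sigma> * w $ k)\<^sup>2 \<le> a * (2 * (snd x $ k)\<^sup>2 + 2 * (\<sigma> * w $ k)\<^sup>2)"
        by (intro mult_left_mono) (auto simp: a_def)
      also have "\<dots> = 2 * a * (snd x $ k)\<^sup>2 + (2 * a * \<sigma>\<^sup>2) * (w $ k)\<^sup>2"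
        by (simp add: power_mult_distrib distrib_left)
      also have "\<dots> \<le> 2 * a * (snd x $ k)\<^sup>2 + (1 / 4) * (w $ k)\<^sup>2"
        using \<sigma> by (intro add_left_mono mult_right_mono) auto
      finally show ?thesis by (simp add: rescaled_point_def \<sigma>_def)
    qed
    then have "(\<Sum>k\<in>UNIV. a * (rescaled_point x w $ k)\<^sup>2) \<le> (\<Sum>k\<in>UNIV. 2 * a * (snd x $ k)\<^sup>2 + (w $ k)\<^sup>2 / 4)"
      by (rule sum_mono)
    moreover have nrm: "(norm y)\<^sup>2 = (\<Sum>k\<in>UNIV. (y $ k)\<^sup>2)" for y :: "real ^ 'n"
      by (simp add: norm_vec_def L2_set_def sum_nonneg)
    ultimately have "a * (norm (rescaled_point x w))\<^sup>2 \<le> 2 * a * (norm (snd x))\<^sup>2 + (\<Sum>k\<in>UNIV. (w $ k)\<^sup>2 / 4)"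
      by (simp add: sum.distrib sum_distrib_left)
    then have "exp (a * (norm (rescaled_point x w))\<^sup>2) \<le> exp (2 * a * (norm (snd x))\<^sup>2) * exp (\<Sum>k\<in>UNIV. (w $ k)\<^sup>2 / 4)"
      by (simp flip: exp_add)
    then have "C * exp (a * (norm (rescaled_point x w))\<^sup>2) \<le> C * (exp (2 * a * (norm (snd x))\<^sup>2) * exp (\<Sum>k\<in>UNIV. (w $ k)\<^sup>2 / 4))"
      by (rule mult_left_mono) (simp add: C_def)
    with f[of "rescaled_point x w"]
    have f': "\<bar>f (rescaled_point x w)\<bar> \<le> C * exp (2 * a * (norm (snd x))\<^sup>2) * exp (\<Sum>k\<in>UNIV. (w $ k)\<^sup>2 / 4)"
      by simp
    have g: "exp (\<Sum>k\<in>UNIV. (w $ k)\<^sup>2 / 4) * (\<Prod>k\<in>UNIV. std_normal_density (w $ k)) = wide_gaussian w"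
    proof -
      have "exp (v\<^sup>2 / 4) * std_normal_density v = sqrt 2 * normal_density 0 (sqrt 2) v" for v
      proof -
        have "exp (v\<^sup>2 / 4) * exp (- v\<^sup>2 / 2) = exp (- v\<^sup>2 / 4)" by (simp flip: exp_add)
        then show ?thesis
          unfolding std_normal_density_def normal_density_def by (simp add: real_sqrt_mult field_simps)
      qed
      then show ?thesis by (simp add: wide_gaussian_def exp_sum prod.distrib[symmetric])
    qed
    have E: "exp (- (\<Sum>k\<in>UNIV. (mehler_A (d $ k) (fst x) - mehler_B (d $ k) (fst x)) *
       ((snd x $ k)\<^sup>2 + (rescaled_point x w $ k)\<^sup>2) / 2)) \<le> 1"
      using damp by (simp add: sum_nonneg)
    have N: "(\<Prod>k\<in>UNIV. std_normal_density (w $ k)) \<ge> 0"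
      by (intro prod_nonneg) simp
    have "\<bar>rescaled_integrand x w\<bar> = exp (- (\<Sum>k\<in>UNIV. (mehler_A (d $ k) (fst x) - mehler_B (d $ k) (fst x)) *
       ((snd x $ k)\<^sup>2 + (rescaled_point x w $ k)\<^sup>2) / 2)) * \<bar>f (rescaled_point x w)\<bar> * (\<Prod>k\<in>UNIV. std_normal_density (w $ k))"
      unfolding rescaled_integrand_def abs_mult using N by simp
    also have "\<dots> \<le> 1 * \<bar>f (rescaled_point x w)\<bar> * (\<Prod>k\<in>UNIV. std_normal_density (w $ k))"
      using E N by (intro mult_right_mono) auto
    also have "\<dots> \<le> (C * exp (2 * a * (norm (snd x))\<^sup>2) * exp (\<Sum>k\<in>UNIV. (w $ k)\<^sup>2 / 4)) *
        (\<Prod>k\<in>UNIV. std_normal_density (w $ k))"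
      using f' N by (intro mult_right_mono) auto
    also have "\<dots> = C * exp (2 * a * (norm (snd x))\<^sup>2) * wide_gaussian w"
      by (simp only: mult.assoc g)
    finally show ?thesis .
  qed
  then show ?thesis using that[of C "2 * a" \<delta>] \<delta> by (auto simp: C_def a_def)
qed

section \<open>The integral solves the Cauchy problem\<close>

definition solution :: "real \<times> (real ^ 'n) \<Rightarrow> real" where
  "solution x = (if fst x = 0 then f (snd x) else \<integral>z. K x z * f z \<partial>lborel)"

lemma solution_eq_rescaled:
  assumes "fst x \<ge> 0"
  shows "solution x = (\<integral>w. rescaled_integrand x w \<partial>lborel)"
proof (cases "fst x = 0")
  case True
  then have "rescaled_integrand x = (\<lambda>w. f (snd x) * (\<Prod>k\<in>UNIV. std_normal_density (w $ k)))"
    using rescaled_integrand_initial by (cases x) auto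
  moreover have "(\<integral>w. f (snd x) * (\<Prod>k\<in>UNIV. std_normal_density ((w :: real ^ 'n) $ k)) \<partial>lborel) = f (snd x) * 1"
    using has_bochner_integral_integral_eq[OF has_bochner_integral_prod_normal_density[of 1, where 'n = 'n]]
    by simp
  ultimately show ?thesis using True by (simp add: solution_def)
next
  case False
  then have "fst x > 0" using assms by simp
  from integral_kernel_eq_rescaled[OF this] show ?thesis using False by (simp add: solution_def)
qed

lemma solution_eq_moment: "fst x > 0 \<Longrightarrow> solution x = moment (\<lambda>_ _. 1) x"
  by (simp add: solution_def moment_def)

lemma tempered_one: "tempered (\<lambda>_ _. 1)"
  by (rule tempered_coeff) (rule continuous_on_const)

text \<open>
  Two relatively open pieces: the rescaled integral covers the times below \<open>\<delta>\<close>, the initial time included,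
  and the moment representation the positive times.
\<close>

lemma continuous_on_solution: "continuous_on ({0..} \<times> UNIV) solution"
proof -
  obtain C a \<delta> where C: "C \<ge> 0" "a \<ge> 0" and \<delta>: "\<delta> > 0" and
    dom: "\<And>x w. fst x \<in> {0..\<delta>} \<Longrightarrow> \<bar>rescaled_integrand x w\<bar> \<le> C * exp (a * (norm (snd x))\<^sup>2) * wide_gaussian w"
    using rescaled_integrand_dominated by metis
  have wide: "wide_gaussian w \<ge> 0" for w
    unfolding wide_gaussian_def by (intro prod_nonneg) (simp add: normal_density_nonneg)
  have "continuous_on ({0..<\<delta>} \<times> UNIV) (\<lambda>x. \<integral>w. rescaled_integrand x w \<partial>lborel)"
  proof (rule continuous_on_integral_dominated)
    show "rescaled_integrand x \<in> borel_measurable lborel" for x by (rule rescaled_integrand_measurable)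
    show "continuous_on ({0..<\<delta>} \<times> UNIV) (\<lambda>x. rescaled_integrand x w)" for w
      by (rule continuous_on_subset[OF continuous_on_rescaled_integrand]) auto
    fix x :: "real \<times> (real ^ 'n)" assume "x \<in> {0..<\<delta>} \<times> UNIV"
    let ?g = "\<lambda>w. C * exp (a * (norm (snd x) + 1)\<^sup>2) * wide_gaussian w"
    have "\<bar>rescaled_integrand x' w\<bar> \<le> ?g w" if x': "x' \<in> {0..<\<delta>} \<times> UNIV \<inter> ball x 1" for x' w
    proof -
      have "dist (snd x) (snd x') < 1" using x' dist_snd_le[of x x'] by simp
      then have "norm (snd x') \<le> norm (snd x) + 1"
        using norm_triangle_ineq2[of "snd x'" "snd x"] by (simp add: dist_norm norm_minus_commute)
      then have "C * exp (a * (norm (snd x'))\<^sup>2) * wide_gaussian w \<le> ?g w"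
        using C wide by (intro mult_right_mono mult_left_mono) (auto intro!: mult_left_mono power_mono)
      moreover have "fst x' \<in> {0..\<delta>}" using x' by auto
      ultimately show ?thesis using dom[of x' w] by linarith
    qed
    moreover have "integrable lborel ?g" by (intro integrable_mult_right integrable_wide_gaussian)
    ultimately show "\<exists>e>0. \<exists>g. integrable lborel g \<and>
        (\<forall>x'\<in>{0..<\<delta>} \<times> UNIV \<inter> ball x e. \<forall>w\<in>space lborel. \<bar>rescaled_integrand x' w\<bar> \<le> g w)"
      by (intro exI[of _ 1] exI[of _ ?g] conjI ballI) auto
  qed
  then have 1: "continuous_on ({0..<\<delta>} \<times> UNIV) solution"
    by (rule continuous_on_eq) (auto simp: solution_eq_rescaled)
  have 2: "continuous_on ({0<..} \<times> UNIV) solution"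
    by (rule continuous_on_eq[OF continuous_on_moment[OF tempered_one]]) (auto simp: solution_eq_moment)
  have un: "{0..} \<times> UNIV = ({0..<\<delta>} \<times> UNIV) \<union> ({0<..} \<times> (UNIV :: (real ^ 'n) set))"
    using \<delta> by auto
  show ?thesis
    unfolding un
  proof (rule continuous_on_Un_local_open[OF _ _ 1 2])
    let ?U = "({0..<\<delta>} \<times> UNIV) \<union> ({0<..} \<times> (UNIV :: (real ^ 'n) set))"
    have "?U \<inter> ({..<\<delta>} \<times> UNIV) = {0..<\<delta>} \<times> UNIV" "?U \<inter> ({0<..} \<times> UNIV) = {0<..} \<times> UNIV"
      by (auto simp del: Times_Un_distrib1)
    then show "openin (top_of_set ?U) ({0..<\<delta>} \<times> UNIV)" "openin (top_of_set ?U) ({0<..} \<times> UNIV)"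
      using openin_open_Int[OF open_Times[OF open_lessThan open_UNIV], of ?U \<delta>]
        openin_open_Int[OF open_positive_times, of ?U] by (simp_all only:)
  qed
qed

text \<open>
  Up to time \<open>\<delta>\<close> the rescaled integrand is bounded by a Gaussian; after that the kernel is bounded by the
  kernel at a time \<open>T'\<close> beyond \<open>T\<close>.
\<close>

lemma solution_growth:
  "\<exists>C a. \<forall>\<tau>\<in>{0..T}. \<forall>y. \<bar>solution (\<tau>, y)\<bar> \<le> C * exp (a * (norm y)\<^sup>2)"
proof -
  obtain C a \<delta> where C: "C \<ge> 0" "a \<ge> 0" and \<delta>: "\<delta> > 0" and
    dom: "\<And>x w. fst x \<in> {0..\<delta>} \<Longrightarrow> \<bar>rescaled_integrand x w\<bar> \<le> C * exp (a * (norm (snd x))\<^sup>2) * wide_gaussian w"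
    using rescaled_integrand_dominated by metis
  define W where "W = (\<integral>w. wide_gaussian w \<partial>lborel)"
  have wide: "wide_gaussian w \<ge> 0" for w
    unfolding wide_gaussian_def by (intro prod_nonneg) (simp add: normal_density_nonneg)
  then have W: "W \<ge> 0" unfolding W_def by (intro Bochner_Integration.integral_nonneg)
  have short: "\<bar>solution (\<tau>, y)\<bar> \<le> (C * W) * exp (a * (norm y)\<^sup>2)" if "\<tau> \<in> {0..\<delta>}" for \<tau> y
  proof -
    have "\<bar>\<integral>w. rescaled_integrand (\<tau>, y) w \<partial>lborel\<bar> \<le> (\<integral>w. C * exp (a * (norm y)\<^sup>2) * wide_gaussian w \<partial>lborel)"
      using dom[of "(\<tau>, y)"] that rescaled_integrand_measurable
      by (intro integral_abs_bound_integral Bochner_Integration.integrable_bound[OF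
            integrable_mult_right[OF integrable_wide_gaussian], of _ "C * exp (a * (norm y)\<^sup>2)"]
          integrable_mult_right integrable_wide_gaussian AE_I2)
         (auto simp: C wide abs_mult)
    then show ?thesis
      using that by (simp add: solution_eq_rescaled W_def mult_ac)
  qed
  define T' where "T' = max T \<delta> + 1"
  have T': "T < T'" "T' > 0" using \<delta> by (auto simp: T'_def)
  obtain c b where c: "c \<ge> 0" "b \<ge> 0" and
    kdom: "\<And>\<tau> y z. \<tau> \<in> {\<delta>..T} \<Longrightarrow>
       exp (0 * norm z) * mehler_kernel d \<tau> y z \<le> c * exp (b * (norm y)\<^sup>2) * mehler_kernel d T' 0 z"
    using mehler_kernel_dominated[OF d_nonneg \<delta> T'(1), of 0] by metis
  define I where "I = (\<integral>z. \<bar>mehler_kernel d T' 0 z * f z\<bar> \<partial>lborel)"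
  have I: "I \<ge> 0" unfolding I_def by (intro Bochner_Integration.integral_nonneg) simp
  have long: "\<bar>solution (\<tau>, y)\<bar> \<le> (c * I) * exp (b * (norm y)\<^sup>2)" if \<tau>: "\<tau> \<in> {\<delta>..T}" for \<tau> y
  proof -
    have pos: "fst (\<tau>, y) > 0" using \<tau> \<delta> by simp
    have "\<bar>\<integral>z. K (\<tau>, y) z * f z \<partial>lborel\<bar> \<le>
        (\<integral>z. c * exp (b * (norm y)\<^sup>2) * \<bar>mehler_kernel d T' 0 z * f z\<bar> \<partial>lborel)"
    proof (rule integral_abs_bound_integral)
      show "integrable lborel (\<lambda>z. K (\<tau>, y) z * f z)"
        using integrand_integrable[OF tempered_one pos] by simp
      show "integrable lborel (\<lambda>z. c * exp (b * (norm y)\<^sup>2) * \<bar>mehler_kernel d T' 0 z * f z\<bar>)"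
        by (intro integrable_mult_right integrable_abs integrable_origin T')
      fix z
      have "mehler_kernel d \<tau> y z * \<bar>f z\<bar> \<le> c * exp (b * (norm y)\<^sup>2) * mehler_kernel d T' 0 z * \<bar>f z\<bar>"
        using kdom[OF \<tau>, of z y] by (intro mult_right_mono) auto
      moreover have "mehler_kernel d \<tau> y z > 0" "mehler_kernel d T' 0 z > 0"
        by (simp_all add: mehler_kernel_def)
      ultimately show "\<bar>K (\<tau>, y) z * f z\<bar> \<le> c * exp (b * (norm y)\<^sup>2) * \<bar>mehler_kernel d T' 0 z * f z\<bar>"
        by (simp add: abs_mult mult.assoc)
    qed
    then show ?thesis
      using pos by (simp add: solution_def I_def mult_ac)
  qed
  have le: "c1 * exp (m * r) \<le> (C * W + c * I) * exp ((a + b) * r)"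
    if "c1 \<le> C * W + c * I" "m \<le> a + b" "r \<ge> 0" for c1 m r
    using that C c W I by (intro mult_mono) (auto intro: mult_right_mono)
  have "\<bar>solution (\<tau>, y)\<bar> \<le> (C * W + c * I) * exp ((a + b) * (norm y)\<^sup>2)" if "\<tau> \<in> {0..T}" for \<tau> y
  proof (cases "\<tau> \<le> \<delta>")
    case True
    then have "\<tau> \<in> {0..\<delta>}" using that by simp
    from order_trans[OF short[OF this] le] show ?thesis using C c W I by simp
  next
    case False
    then have "\<tau> \<in> {\<delta>..T}" using that by simp
    from order_trans[OF long[OF this] le] show ?thesis using C c W I by simp
  qed
  then show ?thesis by blast
qed

lemma solution_derivative_time:
  assumes "\<tau> > 0"
  shows "((\<lambda>s. solution (s, y)) has_real_derivative moment rate (\<tau>, y)) (at \<tau>)"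
proof -
  have "((\<lambda>s. moment (\<lambda>_ _. 1) ((\<tau>, y) + s *\<^sub>R (1, 0))) has_real_derivative moment rate (\<tau>, y)) (at 0)"
  proof (rule moment_has_directional_derivative[OF tempered_one tempered_rate])
    show "((\<lambda>s. 1 * K (x + s *\<^sub>R (1, 0)) z) has_real_derivative rate x z * K x z) (at 0)"
      if "fst x > 0" for x z
      unfolding mult_1 by (rule mehler_kernel_derivative_time[OF that])
  qed (simp_all add: assms norm_Pair)
  then have "((\<lambda>s. moment (\<lambda>_ _. 1) (s + \<tau>, y)) has_real_derivative moment rate (\<tau>, y)) (at 0)"
    by (simp add: add.commute)
  then have "((\<lambda>s. moment (\<lambda>_ _. 1) (s, y)) has_real_derivative moment rate (\<tau>, y)) (at \<tau>)"
    using DERIV_shift[of "\<lambda>s. moment (\<lambda>_ _. 1) (s, y)" _ 0 \<tau>] by simp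
  then show ?thesis
    by (rule has_field_derivative_transform_within_open[of _ _ _ "{0<..}"])
       (use assms in \<open>auto simp: solution_eq_moment\<close>)
qed

lemma norm_space_direction: "norm (0 :: real, axis k 1 :: real ^ 'n) \<le> 1"
  by (simp add: norm_Pair norm_axis_1)

lemma solution_derivative_space:
  assumes "\<tau> > 0"
  shows "((\<lambda>s. solution (\<tau>, y + s *\<^sub>R axis k 1)) has_real_derivative moment (slope k) (\<tau>, y)) (at 0)"
proof -
  have "((\<lambda>s. moment (\<lambda>_ _. 1) ((\<tau>, y) + s *\<^sub>R (0, axis k 1))) has_real_derivative moment (slope k) (\<tau>, y)) (at 0)"
  proof (rule moment_has_directional_derivative[OF tempered_one tempered_slope _ norm_space_direction])
    show "((\<lambda>s. 1 * K (x + s *\<^sub>R (0, axis k 1)) z) has_real_derivative slope k x z * K x z) (at 0)" for x z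
      unfolding mult_1 by (rule mehler_kernel_derivative_space)
  qed (simp add: assms)
  then show ?thesis using assms by (simp add: solution_eq_moment)
qed

lemma slope_moment_derivative_space:
  assumes "\<tau> > 0"
  shows "((\<lambda>s. moment (slope k) (\<tau>, y + s *\<^sub>R axis l 1)) has_real_derivative moment (curvature k l) (\<tau>, y)) (at 0)"
proof -
  have "((\<lambda>s. moment (slope k) ((\<tau>, y) + s *\<^sub>R (0, axis l 1))) has_real_derivative moment (curvature k l) (\<tau>, y)) (at 0)"
    by (rule moment_has_directional_derivative[OF tempered_slope tempered_curvature _ norm_space_direction])
       (simp_all only: slope_kernel_derivative_space fst_conv assms)
  then show ?thesis by simp
qed

lemma partial_solution:
  assumes "\<tau> > 0"
  shows "partial k (\<lambda>y. solution (\<tau>, y)) = (\<lambda>y. moment (slope k) (\<tau>, y))"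
  unfolding partial_def by (rule ext) (rule DERIV_imp_deriv[OF solution_derivative_space[OF assms]])

lemma partial_partial_solution:
  assumes "\<tau> > 0"
  shows "partial l (partial k (\<lambda>y. solution (\<tau>, y))) = (\<lambda>y. moment (curvature k l) (\<tau>, y))"
  unfolding partial_solution[OF assms] unfolding partial_def
  by (rule ext) (rule DERIV_imp_deriv[OF slope_moment_derivative_space[OF assms]])

text \<open>
  The differential equation, integrated against the initial value.
\<close>

lemma moment_rate:
  assumes "\<tau> > 0"
  shows "moment rate (\<tau>, y) = laplacian (\<lambda>y. solution (\<tau>, y)) y - inner y (diagonal d *v y) * solution (\<tau>, y)"
proof -
  have pos: "fst (\<tau>, y) > 0" using assms by simp
  have "moment rate (\<tau>, y) =
      (\<integral>z. (\<Sum>k\<in>UNIV. curvature k k (\<tau>, y) z * K (\<tau>, y) z * f z)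
         - (\<Sum>k\<in>UNIV. d $ k * (y $ k)\<^sup>2) * (1 * K (\<tau>, y) z * f z) \<partial>lborel)"
    unfolding moment_def rate_def by (simp add: left_diff_distrib sum_distrib_right mult.assoc)
  also have "\<dots> = (\<Sum>k\<in>UNIV. \<integral>z. curvature k k (\<tau>, y) z * K (\<tau>, y) z * f z \<partial>lborel)
         - (\<Sum>k\<in>UNIV. d $ k * (y $ k)\<^sup>2) * (\<integral>z. 1 * K (\<tau>, y) z * f z \<partial>lborel)"
    using integrand_integrable[OF tempered_curvature pos] integrand_integrable[OF tempered_one pos]
    by (subst Bochner_Integration.integral_diff)
       (auto intro!: integrable_mult_right Bochner_Integration.integral_sum simp del: mult_1)
  finally show ?thesis
    unfolding inner_diagonal laplacian_def partial_partial_solution[OF assms] solution_eq_moment[OF pos]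
    by (simp add: moment_def)
qed

lemma cauchy_solution_mehler:
  "cauchy_solution (diagonal d) t0 f (\<lambda>t y. solution (t - t0, y))"
proof -
  have shift: "continuous_on ({t0<..} \<times> UNIV) (\<lambda>(t, y). moment P (t - t0, y))" if "tempered P" for P
  proof -
    have "continuous_on ({t0<..} \<times> UNIV) (\<lambda>ty. moment P (fst ty - t0, snd ty))"
      by (rule continuous_on_compose2[OF continuous_on_moment[OF that]]) (auto intro!: continuous_intros)
    then show ?thesis by (simp add: case_prod_unfold)
  qed
  have time: "((\<lambda>s. solution (s - t0, y)) has_real_derivative moment rate (t - t0, y)) (at t)" if "t > t0" for t y
    using DERIV_shift[of "\<lambda>s. solution (s, y)" _ t "- t0"] solution_derivative_time[of "t - t0" y] that by simp
  have deriv: "deriv (\<lambda>s. solution (s - t0, y)) t = moment rate (t - t0, y)" if "t > t0" for t y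
    by (rule DERIV_imp_deriv[OF time[OF that]])
  have "C12 t0 (\<lambda>t y. solution (t - t0, y))"
    unfolding C12_def
  proof (intro conjI allI impI)
    fix t y k l assume t: "t > t0"
    show "(\<lambda>s. solution (s - t0, y)) differentiable (at t)"
      using time[OF t] real_differentiable_def by blast
    show "partially_differentiable k (\<lambda>y. solution (t - t0, y)) y"
      unfolding partially_differentiable_def using solution_derivative_space[of "t - t0" y k] t
      by (auto simp: real_differentiable_def)
    show "partially_differentiable l (partial k (\<lambda>y. solution (t - t0, y))) y"
      unfolding partially_differentiable_def using slope_moment_derivative_space[of "t - t0" k y l] t
      by (auto simp: real_differentiable_def partial_solution)
  next
    show "continuous_on ({t0<..} \<times> UNIV) (\<lambda>(t, y). deriv (\<lambda>s. solution (s - t0, y)) t)"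
      by (rule continuous_on_eq[OF shift[OF tempered_rate]]) (auto simp: deriv)
    show "continuous_on ({t0<..} \<times> UNIV) (\<lambda>(t, y). partial k (\<lambda>y. solution (t - t0, y)) y)" for k
      by (rule continuous_on_eq[OF shift[OF tempered_slope]]) (auto simp: partial_solution)
    show "continuous_on ({t0<..} \<times> UNIV) (\<lambda>(t, y). partial l (partial k (\<lambda>y. solution (t - t0, y))) y)" for k l
      by (rule continuous_on_eq[OF shift[OF tempered_curvature]]) (auto simp: partial_partial_solution)
  qed
  moreover have "continuous_on ({t0..} \<times> UNIV) (\<lambda>(t, y). solution (t - t0, y))"
  proof -
    have "continuous_on ({t0..} \<times> UNIV) (\<lambda>ty. solution (fst ty - t0, snd ty))"
      by (rule continuous_on_compose2[OF continuous_on_solution]) (auto intro!: continuous_intros)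
    then show ?thesis by (simp add: case_prod_unfold)
  qed
  moreover have "\<exists>C a. \<forall>t\<in>{t0..T}. \<forall>y. \<bar>solution (t - t0, y)\<bar> \<le> C * exp (a * (norm y)\<^sup>2)" for T
  proof -
    obtain C a where "\<forall>\<tau>\<in>{0..T - t0}. \<forall>y. \<bar>solution (\<tau>, y)\<bar> \<le> C * exp (a * (norm y)\<^sup>2)"
      using solution_growth by blast
    then show ?thesis by (intro exI[of _ C] exI[of _ a]) auto
  qed
  moreover have "deriv (\<lambda>s. solution (s - t0, y)) t = laplacian (\<lambda>y. solution (t - t0, y)) y
      - inner y (diagonal d *v y) * solution (t - t0, y)" if "t > t0" for t y
    unfolding deriv[OF that] using that by (intro moment_rate) simp
  moreover have "solution (t0 - t0, y) = f y" for y by (simp add: solution_def)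
  ultimately show ?thesis
    unfolding cauchy_solution_def by blast
qed

end

section \<open>Uniqueness under Tychonoff's growth condition\<close>

lemma second_derivative_nonpos_at_max:
  fixes g g' :: "real \<Rightarrow> real"
  assumes g: "\<And>s. (g has_real_derivative g' s) (at s)"
    and g': "(g' has_real_derivative c) (at 0)"
    and max: "\<And>s. g s \<le> g 0"
  shows "c \<le> 0"
proof (rule ccontr)
  assume "\<not> c \<le> 0"
  then obtain \<delta> where \<delta>: "\<delta> > 0" "\<And>h. 0 < h \<Longrightarrow> h < \<delta> \<Longrightarrow> g' 0 < g' (0 + h)"
    using DERIV_pos_inc_right[OF g', of] by auto
  have "g' 0 = 0" using DERIV_local_max[OF g[of 0], of 1] max by auto
  obtain z where z: "0 < z" "z < \<delta> / 2" "g (\<delta> / 2) - g 0 = (\<delta> / 2 - 0) * g' z"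
    using MVT2[of 0 "\<delta> / 2" g g'] g \<delta>(1) by auto
  have "0 < g' z" using \<delta>(2)[of z] \<open>g' 0 = 0\<close> z(1,2) \<delta>(1) by simp
  then have "0 < (\<delta> / 2) * g' z" using \<delta>(1) by simp
  with z(3) max[of "\<delta> / 2"] show False by simp
qed

lemma partial_has_real_derivative:
  assumes "\<And>y. partially_differentiable k f y"
  shows "((\<lambda>\<sigma>. f (y + \<sigma> *\<^sub>R axis k 1)) has_real_derivative partial k f (y + \<sigma> *\<^sub>R axis k 1)) (at \<sigma>)"
proof -
  have "((\<lambda>s. f ((y + \<sigma> *\<^sub>R axis k 1) + s *\<^sub>R axis k 1)) has_real_derivative
      partial k f (y + \<sigma> *\<^sub>R axis k 1)) (at 0)"
    using assms[of "y + \<sigma> *\<^sub>R axis k 1"] unfolding partially_differentiable_def partial_def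
    by (simp only: DERIV_deriv_iff_real_differentiable)
  moreover have "(y + \<sigma> *\<^sub>R axis k 1) + s *\<^sub>R axis k 1 = y + (s + \<sigma>) *\<^sub>R axis k (1 :: real)" for s
    by (simp add: scaleR_add_left)
  ultimately show ?thesis
    using DERIV_shift[of "\<lambda>\<sigma>. f (y + \<sigma> *\<^sub>R axis k 1)" _ 0 \<sigma>] by simp
qed

text \<open>
  For \<open>exp (\<phi> |y|\<^sup>2 + \<psi>)\<close> to be a supersolution of the heat equation one needs \<open>\<phi>' \<ge> 4 \<phi>\<^sup>2\<close> and
  \<open>\<psi>' \<ge> 2 n \<phi>\<close>. On an interval of length \<open>1 / (16 b)\<close> the linear choice \<open>\<phi> = b + 16 b\<^sup>2 (t - s)\<close>
  is at most \<open>2 b\<close>, so that its slope \<open>16 b\<^sup>2\<close> is large enough, and \<open>\<psi>' = 4 n b + 1\<close> makes the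
  inequality strict. The condition on \<open>\<phi>\<close> forces blow-up in finite time, hence the restriction to
  short intervals.
\<close>

definition barrier :: "real \<Rightarrow> real \<Rightarrow> real \<Rightarrow> real ^ 'n \<Rightarrow> real" where
  "barrier b s t y = exp ((b + 16 * b\<^sup>2 * (t - s)) * (norm y)\<^sup>2 + (4 * real CARD('n) * b + 1) * (t - s))"

lemma barrier_derivative_time:
  "((\<lambda>t. barrier b s t y) has_real_derivative
     (16 * b\<^sup>2 * (norm y)\<^sup>2 + (4 * real CARD('n) * b + 1)) * barrier b s t (y :: real ^ 'n)) (at t)"
proof -
  have "((\<lambda>t. (b + 16 * b\<^sup>2 * (t - s)) * (norm y)\<^sup>2 + (4 * real CARD('n) * b + 1) * (t - s)) has_real_derivative
      16 * b\<^sup>2 * (norm y)\<^sup>2 + (4 * real CARD('n) * b + 1)) (at t)"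
    by (auto intro!: derivative_eq_intros)
  from DERIV_chain2[OF DERIV_exp this] show ?thesis
    unfolding barrier_def by (simp add: mult.commute)
qed

lemma barrier_derivative_space:
  fixes y :: "real ^ 'n" and b s :: real
  defines "\<phi> t \<equiv> b + 16 * b\<^sup>2 * (t - s)"
  shows "((\<lambda>\<sigma>. barrier b s t (y + \<sigma> *\<^sub>R axis k 1)) has_real_derivative
      2 * \<phi> t * (y $ k + \<sigma>) * barrier b s t (y + \<sigma> *\<^sub>R axis k 1)) (at \<sigma>)"
proof -
  have n: "(norm (y + \<sigma> *\<^sub>R axis k 1))\<^sup>2 = (norm y)\<^sup>2 + 2 * \<sigma> * y $ k + \<sigma>\<^sup>2" for \<sigma>
    unfolding power2_norm_eq_inner
    by (simp add: inner_add_left inner_add_right inner_axis inner_axis' power2_eq_square distrib_left)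
  have "((\<lambda>\<sigma>. \<phi> t * ((norm y)\<^sup>2 + 2 * \<sigma> * y $ k + \<sigma>\<^sup>2) + (4 * real CARD('n) * b + 1) * (t - s)) has_real_derivative
      \<phi> t * (2 * y $ k + 2 * \<sigma>) + 0) (at \<sigma>)"
    by (auto intro!: derivative_eq_intros)
  from DERIV_chain2[OF DERIV_exp this] show ?thesis
    unfolding barrier_def n \<phi>_def[symmetric] by (simp add: algebra_simps)
qed

lemma barrier_second_derivative_space:
  fixes y :: "real ^ 'n" and b s :: real
  defines "\<phi> t \<equiv> b + 16 * b\<^sup>2 * (t - s)"
  shows "((\<lambda>\<sigma>. 2 * \<phi> t * (y $ k + \<sigma>) * barrier b s t (y + \<sigma> *\<^sub>R axis k 1)) has_real_derivative
      (2 * \<phi> t + 4 * (\<phi> t)\<^sup>2 * (y $ k)\<^sup>2) * barrier b s t y) (at 0)"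
proof -
  have "((\<lambda>\<sigma>. 2 * \<phi> t * (y $ k + \<sigma>)) has_real_derivative 2 * \<phi> t) (at 0)"
    by (auto intro!: derivative_eq_intros)
  from DERIV_mult[OF this barrier_derivative_space[of b s t y k 0, folded \<phi>_def]]
  have "((\<lambda>\<sigma>. 2 * \<phi> t * (y $ k + \<sigma>) * barrier b s t (y + \<sigma> *\<^sub>R axis k 1)) has_real_derivative
      2 * \<phi> t * barrier b s t y + 2 * \<phi> t * y $ k * barrier b s t y * (2 * \<phi> t * y $ k)) (at 0)"
    unfolding scaleR_zero_left add_0_right .
  then show ?thesis by (rule DERIV_cong) (simp add: power2_eq_square algebra_simps)
qed

lemma barrier_supersolution:
  fixes y :: "real ^ 'n" and b s :: real
  assumes b: "b > 0" and t: "s \<le> t" "t \<le> s + 1 / (16 * b)"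
  defines "\<phi> \<equiv> b + 16 * b\<^sup>2 * (t - s)"
  shows "(\<Sum>k\<in>UNIV. (2 * \<phi> + 4 * \<phi>\<^sup>2 * (y $ k)\<^sup>2) * barrier b s t y)
    < (16 * b\<^sup>2 * (norm y)\<^sup>2 + (4 * real CARD('n) * b + 1)) * barrier b s t y"
proof -
  have "16 * b\<^sup>2 * (t - s) \<le> 16 * b\<^sup>2 * (1 / (16 * b))" using t b by (intro mult_left_mono) auto
  also have "\<dots> = b" using b by (simp add: power2_eq_square)
  finally have \<phi>: "\<phi> \<le> 2 * b" "0 \<le> \<phi>" using t b by (auto simp: \<phi>_def)
  have "\<phi>\<^sup>2 \<le> (2 * b)\<^sup>2" by (rule power_mono[OF \<phi>])
  then have "4 * \<phi>\<^sup>2 * (norm y)\<^sup>2 \<le> 16 * b\<^sup>2 * (norm y)\<^sup>2"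
    by (intro mult_right_mono) (auto simp: power_mult_distrib)
  moreover have "2 * \<phi> * real CARD('n) \<le> 4 * real CARD('n) * b"
    using mult_right_mono[OF \<phi>(1), of "2 * real CARD('n)"] by (simp add: mult_ac)
  moreover have "(norm y)\<^sup>2 = (\<Sum>k\<in>UNIV. (y $ k)\<^sup>2)"
    by (simp add: norm_vec_def L2_set_def sum_nonneg)
  then have "(\<Sum>k\<in>UNIV. 2 * \<phi> + 4 * \<phi>\<^sup>2 * (y $ k)\<^sup>2) = 2 * \<phi> * real CARD('n) + 4 * \<phi>\<^sup>2 * (norm y)\<^sup>2"
    by (simp add: sum.distrib sum_distrib_left mult_ac)
  ultimately have "(\<Sum>k\<in>UNIV. 2 * \<phi> + 4 * \<phi>\<^sup>2 * (y $ k)\<^sup>2) < 16 * b\<^sup>2 * (norm y)\<^sup>2 + (4 * real CARD('n) * b + 1)"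
    by linarith
  then show ?thesis
    unfolding sum_distrib_right[symmetric] by (rule mult_strict_right_mono) (simp add: barrier_def)
qed

lemma cauchy_solutionD:
  assumes "cauchy_solution D t0 u0 u" "t0 < t"
  shows "(\<lambda>s. u s y) differentiable (at t)"
    and "partially_differentiable k (u t) y"
    and "partially_differentiable l (partial k (u t)) y"
    and "deriv (\<lambda>s. u s y) t = laplacian (u t) y - inner y (D *v y) * u t y"
  using assms by (auto simp: cauchy_solution_def C12_def)

text \<open>
  Suppose that \<open>w = u - v - \<epsilon> barrier\<close> is positive somewhere. As \<open>b > a\<close> it is negative far from
  the origin, so it has a positive maximum over the whole slab, and this is not at the time \<open>s\<close>.
  At the maximum the time derivative is nonnegative (it may be the end of the interval) and the
  Laplacian is nonpositive. Since \<open>u > v\<close> there and the potential is nonnegative, the equation for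
  \<open>u - v\<close> then contradicts the strict inequality for the barrier.
\<close>

lemma cauchy_solution_comparison_short:
  fixes D :: "real ^ 'n ^ 'n"
  assumes u: "cauchy_solution D t0 u0 u" "cauchy_solution D t0 v0 v"
    and V: "\<And>y. inner y (D *v y) \<ge> 0"
    and s: "t0 \<le> s" and e: "e \<le> s + 1 / (16 * b)" and b: "b > a" "b > 0"
    and growth: "\<And>t y. t \<in> {s..e} \<Longrightarrow> \<bar>u t y\<bar> \<le> C * exp (a * (norm y)\<^sup>2)"
      "\<And>t y. t \<in> {s..e} \<Longrightarrow> \<bar>v t y\<bar> \<le> C * exp (a * (norm y)\<^sup>2)"
    and init: "\<And>y. u s y \<le> v s y"
    and t1: "t1 \<in> {s..e}"
  shows "u t1 y1 \<le> v t1 y1"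
proof (rule field_le_epsilon)
  fix \<epsilon>' :: real assume "\<epsilon>' > 0"
  \<comment> \<open>the barrier contributes exactly \<open>\<epsilon>'\<close> at the point under consideration\<close>
  define \<epsilon> where "\<epsilon> = \<epsilon>' / barrier b s t1 y1"
  have G: "barrier b s t y > 0" for t and y :: "real ^ 'n" by (simp add: barrier_def)
  have \<epsilon>: "\<epsilon> > 0" using \<open>\<epsilon>' > 0\<close> G by (simp add: \<epsilon>_def)
  define w where "w t y = u t y - v t y - \<epsilon> * barrier b s t y" for t y
  have "w t1 y1 \<le> 0"
  proof (rule ccontr)
    assume "\<not> w t1 y1 \<le> 0"
    then have w1: "w t1 y1 > 0" by simp
    \<comment> \<open>beyond radius \<open>R\<close> one has \<open>\<epsilon> exp (b |y|\<^sup>2) \<ge> (2 |C| + 1) exp (a |y|\<^sup>2)\<close>; adding \<open>norm y1\<close> keeps the positive value inside\<close>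
    define L where "L = ln ((2 * \<bar>C\<bar> + 1) / \<epsilon>)"
    define R where "R = norm y1 + sqrt (\<bar>L\<bar> / (b - a))"
    have far: "w t y < 0" if t: "t \<in> {s..e}" and y: "norm y \<ge> R" for t y
    proof -
      have "sqrt (\<bar>L\<bar> / (b - a)) \<le> norm y" using y norm_ge_zero[of y1] unfolding R_def by linarith
      then have "(sqrt (\<bar>L\<bar> / (b - a)))\<^sup>2 \<le> (norm y)\<^sup>2" using b by (intro power_mono) auto
      then have "\<bar>L\<bar> \<le> (b - a) * (norm y)\<^sup>2" using b by (simp add: field_simps)
      then have "L + a * (norm y)\<^sup>2 \<le> b * (norm y)\<^sup>2" by (simp add: left_diff_distrib)
      also have "\<dots> \<le> (b + 16 * b\<^sup>2 * (t - s)) * (norm y)\<^sup>2 + (4 * real CARD('n) * b + 1) * (t - s)"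
        using t b by (simp add: distrib_right)
      finally have "exp (L + a * (norm y)\<^sup>2) \<le> barrier b s t y" by (simp add: barrier_def)
      then have "(2 * \<bar>C\<bar> + 1) / \<epsilon> * exp (a * (norm y)\<^sup>2) \<le> barrier b s t y"
        using \<epsilon> by (simp add: exp_add L_def)
      then have "(2 * \<bar>C\<bar> + 1) * exp (a * (norm y)\<^sup>2) \<le> \<epsilon> * barrier b s t y"
        using \<epsilon> by (simp add: field_simps)
      moreover have "C * exp (a * (norm y)\<^sup>2) \<le> \<bar>C\<bar> * exp (a * (norm y)\<^sup>2)" by (intro mult_right_mono) auto
      moreover have "(2 * \<bar>C\<bar> + 1) * exp (a * (norm y)\<^sup>2) = 2 * (\<bar>C\<bar> * exp (a * (norm y)\<^sup>2)) + exp (a * (norm y)\<^sup>2)"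
        by (simp add: distrib_right)
      moreover have "exp (a * (norm y)\<^sup>2) > 0" by simp
      ultimately show ?thesis
        using growth(1)[OF t, of y] growth(2)[OF t, of y] unfolding w_def by linarith
    qed
    let ?S = "{s..e} \<times> cball (0 :: real ^ 'n) R"
    have cont: "continuous_on ?S (\<lambda>(t, y). w t y)"
    proof -
      have "?S \<subseteq> {t0..} \<times> UNIV" using s by auto
      then have "continuous_on ?S (\<lambda>(t, y). u t y)" "continuous_on ?S (\<lambda>(t, y). v t y)"
        using u unfolding cauchy_solution_def by (blast intro: continuous_on_subset)+
      then show ?thesis
        unfolding w_def barrier_def case_prod_unfold by (intro continuous_intros)
    qed
    have in1: "(t1, y1) \<in> ?S" using t1 b by (auto simp: R_def)
    obtain x where x: "x \<in> ?S" "\<And>x'. x' \<in> ?S \<Longrightarrow> (case x' of (t, y) \<Rightarrow> w t y) \<le> (case x of (t, y) \<Rightarrow> w t y)"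
      using continuous_attains_sup[OF _ _ cont] in1 by (metis compact_Icc compact_Times compact_cball empty_iff)
    obtain t y where ty: "x = (t, y)" by (cases x)
    have t: "t \<in> {s..e}" using x(1) ty by simp
    have wpos: "w t y > 0" using x(2)[OF in1] w1 ty by simp
    have max: "w t' y' \<le> w t y" if "t' \<in> {s..e}" for t' y'
    proof (cases "norm y' \<le> R")
      case True
      then show ?thesis using x(2)[of "(t', y')"] that ty by simp
    next
      case False
      then show ?thesis using far[OF that, of y'] wpos by simp
    qed
    have "w s y < 0" using init[of y] mult_pos_pos[OF \<epsilon> G[of s y]] unfolding w_def by linarith
    then have ts: "s < t" using wpos t by (cases "t = s") auto
    then have t0t: "t0 < t" using s by simp
    define \<phi> where "\<phi> = b + 16 * b\<^sup>2 * (t - s)"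
    note ud = cauchy_solutionD[OF u(1) t0t] and vd = cauchy_solutionD[OF u(2) t0t]
    have pd: "partially_differentiable k (u t) y" "partially_differentiable l (partial k (u t)) y"
      "partially_differentiable k (v t) y" "partially_differentiable l (partial k (v t)) y" for k l y
      by (rule ud vd)+
    have space: "partial k (partial k (u t)) y - partial k (partial k (v t)) y
        - \<epsilon> * ((2 * \<phi> + 4 * \<phi>\<^sup>2 * (y $ k)\<^sup>2) * barrier b s t y) \<le> 0" for k
    proof (rule second_derivative_nonpos_at_max)
      show "((\<lambda>\<sigma>. w t (y + \<sigma> *\<^sub>R axis k 1)) has_real_derivative
         partial k (u t) (y + \<sigma> *\<^sub>R axis k 1) - partial k (v t) (y + \<sigma> *\<^sub>R axis k 1)
         - \<epsilon> * (2 * \<phi> * (y $ k + \<sigma>) * barrier b s t (y + \<sigma> *\<^sub>R axis k 1))) (at \<sigma>)" for \<sigma>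
        unfolding w_def \<phi>_def
        by (intro DERIV_diff DERIV_cmult partial_has_real_derivative pd barrier_derivative_space)
      have "((\<lambda>\<sigma>. partial k (u t) (y + \<sigma> *\<^sub>R axis k 1) - partial k (v t) (y + \<sigma> *\<^sub>R axis k 1)
         - \<epsilon> * (2 * \<phi> * (y $ k + \<sigma>) * barrier b s t (y + \<sigma> *\<^sub>R axis k 1))) has_real_derivative
         partial k (partial k (u t)) (y + 0 *\<^sub>R axis k 1) - partial k (partial k (v t)) (y + 0 *\<^sub>R axis k 1)
        - \<epsilon> * ((2 * \<phi> + 4 * \<phi>\<^sup>2 * (y $ k)\<^sup>2) * barrier b s t y)) (at 0)"
        unfolding \<phi>_def
        by (intro DERIV_diff DERIV_cmult partial_has_real_derivative pd barrier_second_derivative_space)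
      then show "((\<lambda>\<sigma>. partial k (u t) (y + \<sigma> *\<^sub>R axis k 1) - partial k (v t) (y + \<sigma> *\<^sub>R axis k 1)
         - \<epsilon> * (2 * \<phi> * (y $ k + \<sigma>) * barrier b s t (y + \<sigma> *\<^sub>R axis k 1))) has_real_derivative
         partial k (partial k (u t)) y - partial k (partial k (v t)) y
        - \<epsilon> * ((2 * \<phi> + 4 * \<phi>\<^sup>2 * (y $ k)\<^sup>2) * barrier b s t y)) (at 0)"
        by simp
      show "w t (y + \<sigma> *\<^sub>R axis k 1) \<le> w t (y + 0 *\<^sub>R axis k 1)" for \<sigma>
        using max[OF t] by simp
    qed
    have "laplacian (u t) y - laplacian (v t) y
        - \<epsilon> * (\<Sum>k\<in>UNIV. (2 * \<phi> + 4 * \<phi>\<^sup>2 * (y $ k)\<^sup>2) * barrier b s t y) \<le> 0"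
      using sum_nonpos[of UNIV, OF space]
      by (simp add: laplacian_def sum_subtractf sum_distrib_left)
    moreover have "\<epsilon> * (\<Sum>k\<in>UNIV. (2 * \<phi> + 4 * \<phi>\<^sup>2 * (y $ k)\<^sup>2) * barrier b s t y)
        < \<epsilon> * ((16 * b\<^sup>2 * (norm y)\<^sup>2 + (4 * real CARD('n) * b + 1)) * barrier b s t y)"
      unfolding \<phi>_def using t e b \<epsilon> by (intro mult_strict_left_mono barrier_supersolution) auto
    moreover define dw where "dw = deriv (\<lambda>s. u s y) t - deriv (\<lambda>s. v s y) t
        - \<epsilon> * ((16 * b\<^sup>2 * (norm y)\<^sup>2 + (4 * real CARD('n) * b + 1)) * barrier b s t y)"
    moreover have "dw \<ge> 0"
    proof (rule ccontr)
      have "((\<lambda>t. w t y) has_real_derivative dw) (at t)"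
        unfolding w_def dw_def
        by (intro DERIV_diff DERIV_cmult barrier_derivative_time)
           (simp_all add: DERIV_deriv_iff_real_differentiable ud(1) vd(1))
      moreover assume "\<not> dw \<ge> 0"
      ultimately obtain \<delta> where \<delta>: "\<delta> > 0" "\<forall>h>0. h < \<delta> \<longrightarrow> w t y < w (t - h) y"
        using DERIV_neg_dec_left[of "\<lambda>t. w t y" dw t] by auto
      define h where "h = min (\<delta> / 2) (t - s)"
      have "0 < h" "h < \<delta>" "t - h \<in> {s..e}" using \<delta>(1) ts t by (auto simp: h_def min_def)
      then show False using \<delta>(2) max[of "t - h" y] by force
    qed
    moreover have "deriv (\<lambda>s. u s y) t = laplacian (u t) y - inner y (D *v y) * u t y"
      "deriv (\<lambda>s. v s y) t = laplacian (v t) y - inner y (D *v y) * v t y"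
      by (rule ud(4) vd(4))+
    moreover have "inner y (D *v y) * (u t y - v t y) \<ge> 0"
      using wpos mult_pos_pos[OF \<epsilon> G[of t y]] V[of y] unfolding w_def by (intro mult_nonneg_nonneg) linarith+
    ultimately show False by (simp add: right_diff_distrib)
  qed
  then show "u t1 y1 \<le> v t1 y1 + \<epsilon>'"
    using G[of t1 y1] by (simp add: w_def \<epsilon>_def)
qed

text \<open>
  The growth constants for \<open>[t0, t]\<close> fix the length \<open>h\<close> of the short intervals, so induction on their number
  reaches \<open>t\<close>.
\<close>

lemma cauchy_solution_le:
  fixes D :: "real ^ 'n ^ 'n"
  assumes u: "cauchy_solution D t0 u0 u" and v: "cauchy_solution D t0 u0 v"
    and V: "\<And>y. inner y (D *v y) \<ge> 0" and t: "t0 \<le> t"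
  shows "u t y \<le> v t y"
proof -
  obtain C1 a1 where 1: "\<And>s y. s \<in> {t0..t} \<Longrightarrow> \<bar>u s y\<bar> \<le> C1 * exp (a1 * (norm y)\<^sup>2)"
    using u t unfolding cauchy_solution_def by blast
  obtain C2 a2 where 2: "\<And>s y. s \<in> {t0..t} \<Longrightarrow> \<bar>v s y\<bar> \<le> C2 * exp (a2 * (norm y)\<^sup>2)"
    using v t unfolding cauchy_solution_def by blast
  define C a b where "C = max \<bar>C1\<bar> \<bar>C2\<bar>" and "a = max \<bar>a1\<bar> \<bar>a2\<bar>" and "b = a + 1"
  have le: "c * exp (m * r) \<le> C * exp (a * r)" if "c \<le> C" "m \<le> a" "r \<ge> 0" for c m r
    using that by (intro mult_mono) (auto simp: C_def intro: mult_right_mono)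
  have g1: "\<bar>u s y\<bar> \<le> C * exp (a * (norm y)\<^sup>2)" if "s \<in> {t0..t}" for s y
    by (rule order_trans[OF 1[OF that] le]) (auto simp: C_def a_def)
  have g2: "\<bar>v s y\<bar> \<le> C * exp (a * (norm y)\<^sup>2)" if "s \<in> {t0..t}" for s y
    by (rule order_trans[OF 2[OF that] le]) (auto simp: C_def a_def)
  have b: "b > a" "b > 0" by (auto simp: b_def a_def)
  define h where "h = 1 / (16 * b)"
  have h: "h > 0" using b by (simp add: h_def)
  have "\<forall>s y. t0 \<le> s \<longrightarrow> s \<le> t \<longrightarrow> s \<le> t0 + real m * h \<longrightarrow> u s y \<le> v s y" for m
  proof (induction m)
    case 0
    then show ?case using u v unfolding cauchy_solution_def by (auto dest: order_antisym)
  next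
    case (Suc m)
    show ?case
    proof (intro allI impI)
      fix s y assume s: "t0 \<le> s" "s \<le> t" "s \<le> t0 + real (Suc m) * h"
      show "u s y \<le> v s y"
      proof (cases "s \<le> t0 + real m * h")
        case True
        then show ?thesis using Suc s by blast
      next
        case False
        have m: "t0 \<le> t0 + real m * h" using h by simp
        show ?thesis
        proof (rule cauchy_solution_comparison_short[OF u v V m, of s])
          show "s \<le> t0 + real m * h + 1 / (16 * b)" using s(3) by (simp add: h_def[symmetric] distrib_right)
          show "\<bar>u t' y\<bar> \<le> C * exp (a * (norm y)\<^sup>2)" "\<bar>v t' y\<bar> \<le> C * exp (a * (norm y)\<^sup>2)"
            if "t' \<in> {t0 + real m * h..s}" for t' y
            using that s m by (auto intro!: g1 g2)
          show "u (t0 + real m * h) y \<le> v (t0 + real m * h) y" for y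
            using Suc m s False by auto
          show "s \<in> {t0 + real m * h..s}" using False by simp
        qed (use b in auto)
      qed
    qed
  qed
  moreover obtain m where "(t - t0) / h \<le> real m" using real_arch_simple by blast
  then have "t \<le> t0 + real m * h" using h by (simp add: field_simps)
  ultimately show ?thesis using t by blast
qed

section \<open>The kernel formula\<close>

text \<open>
  The two forms of the kernel are identified for times after \<open>t0\<close>; values at earlier times must not matter
  when this is transferred to the solutions.
\<close>

lemma cauchy_solution_cong:
  assumes u: "cauchy_solution D t0 u0 u" and eq: "\<And>t. t \<ge> t0 \<Longrightarrow> v t = u t"
  shows "cauchy_solution D t0 u0 v"
proof -
  have diff: "(\<lambda>s. v s y) differentiable (at t)" and deriv: "deriv (\<lambda>s. v s y) t = deriv (\<lambda>s. u s y) t"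
    if t: "t > t0" for t y
  proof -
    have "((\<lambda>s. u s y) has_real_derivative deriv (\<lambda>s. u s y) t) (at t)"
      using cauchy_solutionD(1)[OF u t] by (simp add: DERIV_deriv_iff_real_differentiable)
    then have "((\<lambda>s. v s y) has_real_derivative deriv (\<lambda>s. u s y) t) (at t)"
      by (rule has_field_derivative_transform_within_open[of _ _ _ "{t0<..}"]) (use t eq in auto)
    then show "(\<lambda>s. v s y) differentiable (at t)" "deriv (\<lambda>s. v s y) t = deriv (\<lambda>s. u s y) t"
      by (auto simp: real_differentiable_def intro: DERIV_imp_deriv)
  qed
  have eq': "v t = u t" if "t > t0" for t using eq that by simp
  have cont: "continuous_on ({t0<..} \<times> UNIV) (\<lambda>(t, y). deriv (\<lambda>s. v s y) t)"
    if "continuous_on ({t0<..} \<times> UNIV) (\<lambda>(t, y). deriv (\<lambda>s. u s y) t)"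
    by (rule continuous_on_eq[OF that]) (auto simp: deriv)
  have cont1: "continuous_on ({t0<..} \<times> UNIV) (\<lambda>(t, y). partial k (v t) y)"
    if "continuous_on ({t0<..} \<times> UNIV) (\<lambda>(t, y). partial k (u t) y)" for k
    by (rule continuous_on_eq[OF that]) (auto simp: eq')
  have cont2: "continuous_on ({t0<..} \<times> UNIV) (\<lambda>(t, y). partial l (partial k (v t)) y)"
    if "continuous_on ({t0<..} \<times> UNIV) (\<lambda>(t, y). partial l (partial k (u t)) y)" for k l
    by (rule continuous_on_eq[OF that]) (auto simp: eq')
  have "C12 t0 u" using u by (simp add: cauchy_solution_def)
  then have "C12 t0 v"
    unfolding C12_def by (auto simp: diff eq' intro: cont cont1 cont2)
  moreover have "continuous_on ({t0..} \<times> UNIV) (\<lambda>(t, y). v t y)"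
    by (rule continuous_on_eq[of _ "\<lambda>(t, y). u t y"]) (use u eq in \<open>auto simp: cauchy_solution_def\<close>)
  ultimately show ?thesis
    using u unfolding cauchy_solution_def by (auto simp: deriv eq' eq)
qed

theorem theorem4p9:
  fixes D :: "real ^ 'n ^ 'n" and d :: "real ^ 'n"
    and n p :: nat and i :: "nat \<Rightarrow> 'n"
    and t0 :: real and \<eta>0 :: "real ^ 'n \<Rightarrow> real"
  assumes "n = CARD('n)"
    and "D = diagonal d"
    and "p < n"
    and "card {k. vec_nth d k = 0} = p"
    and "card {k. vec_nth d k > 0} = n - p"
    and "bij_betw i {1..n - p} {k. vec_nth d k > 0}"
    and "bij_betw i {n - p + 1..n} {k. vec_nth d k = 0}"
    and "0 \<le> t0"
    and "continuous_on UNIV \<eta>0"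
    and "\<exists>C a. \<forall>y. \<bar>\<eta>0 y\<bar> \<le> C * exp (a * (norm y)\<^sup>2)"
    and "\<forall>t>t0. \<forall>y. integrable lborel (\<lambda>z. kernel_plus d i p t0 y t z * \<eta>0 z)"
  shows "cauchy_solution D t0 \<eta>0
           (\<lambda>t y. if t = t0 then \<eta>0 y
                   else (\<integral>z. kernel_plus d i p t0 y t z * \<eta>0 z \<partial>lborel)) \<and>
         (\<forall>\<eta>. cauchy_solution D t0 \<eta>0 \<eta> \<longrightarrow>
            (\<forall>t>t0. \<forall>y. \<eta> t y =
               (\<integral>z. kernel_plus d i p t0 y t z * \<eta>0 z \<partial>lborel)))"
proof -
  \<comment> \<open>the zero and the positive entries already account for all \<open>n\<close> indices\<close>
  have nonneg: "d $ k \<ge> 0" for k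
  proof -
    have "card ({k. d $ k = 0} \<union> {k. d $ k > 0}) = card {k. d $ k = 0} + card {k. d $ k > 0}"
      by (rule card_Un_disjoint) auto
    also have "\<dots> = CARD('n)" using assms(1,3,4,5) by simp
    finally have "{k. d $ k = 0} \<union> {k. d $ k > 0} = UNIV"
      by (intro card_subset_eq) auto
    then have "k \<in> {k. d $ k = 0} \<union> {k. d $ k > 0}" by simp
    then show ?thesis by auto
  qed
  have kernel: "kernel_plus d i p t0 y t z = mehler_kernel d (t - t0) y z" if "t > t0" for t y z
    using assms(3) by (intro kernel_plus_eq_mehler_kernel[OF assms(1) _ assms(6,7) nonneg that]) simp
  interpret mehler_cauchy d \<eta>0
  proof
    show "integrable lborel (\<lambda>z. mehler_kernel d \<tau> 0 z * \<eta>0 z)" if "\<tau> > 0" for \<tau>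
    proof -
      have "integrable lborel (\<lambda>z. kernel_plus d i p t0 0 (t0 + \<tau>) z * \<eta>0 z)"
        using assms(11) that by simp
      then show ?thesis using that by (simp add: kernel)
    qed
  qed (use nonneg assms(9,10) in auto)
  have sol: "solution (t - t0, y) = (\<integral>z. kernel_plus d i p t0 y t z * \<eta>0 z \<partial>lborel)" if "t > t0" for t y
    using that by (simp add: solution_def kernel)
  have "cauchy_solution (diagonal d) t0 \<eta>0 (\<lambda>t y. solution (t - t0, y))"
    by (rule cauchy_solution_mehler)
  then have exists: "cauchy_solution D t0 \<eta>0
      (\<lambda>t y. if t = t0 then \<eta>0 y else (\<integral>z. kernel_plus d i p t0 y t z * \<eta>0 z \<partial>lborel))" (is "cauchy_solution D t0 \<eta>0 ?u")
    unfolding assms(2)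
  proof (rule cauchy_solution_cong)
    fix t assume "t \<ge> t0"
    show "?u t = (\<lambda>y. solution (t - t0, y))"
    proof (cases "t = t0")
      case True
      then show ?thesis by (simp add: solution_def)
    next
      case False
      then have "t > t0" using \<open>t \<ge> t0\<close> by simp
      from sol[OF this] show ?thesis using False by (simp add: fun_eq_iff)
    qed
  qed
  have V: "inner y (D *v y) \<ge> 0" for y
    unfolding assms(2) inner_diagonal using nonneg by (intro sum_nonneg) simp
  have "\<eta> t y = ?u t y" if "cauchy_solution D t0 \<eta>0 \<eta>" "t > t0" for \<eta> t y
    using cauchy_solution_le[OF that(1) exists V, of t y] cauchy_solution_le[OF exists that(1) V, of t y] that(2)
    by (intro antisym) auto
  then show ?thesis using exists by auto
qed

end
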